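(* Let $I$ and $J$ be disjoint subsets of $\mathbb N$, $v$ a value, $p_i\in[0,1]$ ($i\in I$), $q_j\in[0,1]$ ($j\in J$). Let $M$ be a well-formed network with $M\equiv N\mid\prod_{i\in I}m_i[\mathsf{snd}\langle v\rangle_{p_i}]^{\nu_{m_i}}\mid\prod_{j\in J}n_j[\mathsf{fwdc}_{q_j}]^{\nu_{n_j}}$ such that for all $i\in I$: (1) $\{n_j : j\in J\}\subseteq\nu_{m_i}\subseteq\mathrm{nds}(M)$; (2) every node $k[P]^{\mu}$ of $N$ with $k\in\nu_{m_i}$ satisfies $\neg\mathrm{rcv}(P)$. Then $N\mid\prod_{i\in I}m_i[\mathsf{nil}]^{\nu_{m_i}}\mid\prod_{j\in J}n_j[\mathsf{resndc}\langle v\rangle_{q_j}]^{\nu_{n_j}}\ \sqsubseteq_r\ M$ with $r=1-\sum_{i\in I}p_i\prod_{j\in I\setminus\{i\}}(1-p_j)$.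
   Context: The process calculus pTCWS. Processes $P,Q$ and probabilistic choices $C,D$ are $P ::= \mathsf{nil} \mid {!}\langle u\rangle.C \mid \lfloor ?(x).C\rfloor D \mid \tau.C \mid \sigma.C \mid X \mid \mathsf{fix}\,X.P$ and $C ::= \bigoplus_{i\in I} p_i{:}P_i$ ($I$ finite non-empty, $p_i\in(0,1]$, $\sum_i p_i=1$); in $\mathsf{fix}\,X.P$ every occurrence of $X$ is time-guarded (under a $\sigma$-prefix or in a timeout branch $D$). $1{:}P$ is written $P$; $P\oplus_pQ$ is $p{:}P\oplus(1-p){:}Q$; ${!}\langle v\rangle$ is ${!}\langle v\rangle.\mathsf{nil}$; $?(x).C$ abbreviates $\mathsf{fix}\,X.\lfloor ?(x).C\rfloor X$ ($X$ not free in $C$). Networks: $M::=\mathbf 0\mid M_1\mid M_2\mid n[P]^\nu\mid\bot$, where $n[P]^\nu$ is a node named $n$ running closed process $P$ with neighbour set $\nu$, and $\bot$ is a stuck network; $\prod$ is iterated $\mid$; $\mathrm{nds}(M)$ is the set of node names. Structural congruence $\equiv$: least equivalence preserved by $\mid$, making $\mid$ a commutative monoid with unit $\mathbf 0$, with $n[\mathsf{fix}\,X.P]^\nu\equiv n[P\{\mathsf{fix}\,X.P/X\}]^\nu$. Well-formed: no node is its own neighbour, distinct names, symmetric neighbourhood, connected neighbour graph; all networks are well-formed. $\mathrm{rcv}(P)$ holds iff $n[P]^\nu\equiv n[\lfloor ?(x).C\rfloor D]^\nu$ for some $x,C,D$ (the node "can receive in the current round"). Semantics: $\mathcal D(\mathcal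 N)$ finite-support probability distributions on networks, $|\Delta|$ total mass of a sub-distribution, $\overline M$ Dirac; $[\![n[\bigoplus_i p_i{:}P_i]^\nu]\!]=\sum_ip_i\overline{n[P_i]^\nu}$; $(\Delta\mid\Theta)(M_1\mid M_2)=\Delta(M_1)\Theta(M_2)$. Transitions $M\xrightarrow{\lambda}\Delta$, $\lambda\in\{m!v\triangleright\nu, m?v,\tau,\sigma\}$, form the least relation closed under: (Snd) $m[{!}\langle v\rangle.C]^\nu\xrightarrow{m!v\triangleright\nu}[\![m[C]^\nu]\!]$; (Rcv) if $m\in\nu$: $n[\lfloor ?(x).C\rfloor D]^\nu\xrightarrow{m?v}[\![n[C\{v/x\}]^\nu]\!]$; $\mathbf 0\xrightarrow{m?v}\overline{\mathbf 0}$; (RcvEnb) if $\neg(m\in\nu\wedge\mathrm{rcv}(P))$ and $m\ne n$: $n[P]^\nu\xrightarrow{m?v}\overline{n[P]^\nu}$; (RcvPar) $M\xrightarrow{m?v}\Delta$, $N\xrightarrow{m?v}\Theta$ give $M\mid N\xrightarrow{m?v}\Delta\mid\Theta$; (Bcast) $M\xrightarrow{m!v\triangleright\nu}\Delta$, $N\xrightarrow{m?v}\Theta$ give $M\mid N\xrightarrow{m!v\triangleright(\nu\setminus\mathrm{nds}(N))}\Delta\mid\Theta$ (and symmetrically); (Tau) $m[\tau.C]^\nu\xrightarrow{\tau}[\![m[C]^\nu]\!]$; (TauPar) $M\xrightarrow{\tau}\Delta$ and $N$ not of the form $\bot\mid N'$ give $M\mid N\xrightarrow{\tau}\Delta\mid\overline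 N$ (and symmetrically); $\mathbf 0\xrightarrow{\sigma}\overline{\mathbf 0}$; $n[\mathsf{nil}]^\nu\xrightarrow{\sigma}\overline{n[\mathsf{nil}]^\nu}$; (Timeout) $n[\lfloor ?(x).C\rfloor D]^\nu\xrightarrow{\sigma}[\![n[D]^\nu]\!]$; (Sleep) $n[\sigma.C]^\nu\xrightarrow{\sigma}[\![n[C]^\nu]\!]$; ($\sigma$-Par) $M\xrightarrow{\sigma}\Delta$, $N\xrightarrow{\sigma}\Theta$ give $M\mid N\xrightarrow{\sigma}\Delta\mid\Theta$; (Rec) $n[P\{\mathsf{fix}\,X.P/X\}]^\nu\xrightarrow{\lambda}\Delta$ gives $n[\mathsf{fix}\,X.P]^\nu\xrightarrow{\lambda}\Delta$; (ShhSnd) $M\xrightarrow{m!v\triangleright\emptyset}\Delta$ gives $M\xrightarrow{\tau}\Delta$; (ObsSnd) $M\xrightarrow{m!v\triangleright\nu}\Delta$ with $\nu\ne\emptyset$ gives $M\xrightarrow{!v\triangleright\nu}\Delta$. $\bot$ has no transitions. $\alpha$ ranges over $!v\triangleright\nu$, $m?v$, $\sigma$, $\tau$. Weak transitions: $M\xrightarrow{\hat\tau}\Delta$ iff $M\xrightarrow{\tau}\Delta$ or $\Delta=\overline M$; for $\alpha\ne\tau$, $\xrightarrow{\hat\alpha}=\xrightarrow{\alpha}$. For $\Delta=\sum_{i\in I}p_i\overline{M_i}$, $\Delta\xrightarrow{\hat\alpha}\Theta$ iff for some non-empty $J\subseteq I$, $M_j\xrightarrow{\hat\alpha}\Theta_j$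 ($j\in J$), $M_i$ has no $\hat\alpha$-transition ($i\notin J$), and $\Theta=\sum_{j\in J}p_j\Theta_j$. $\overset{\hat\tau}{\Longrightarrow}$ is the reflexive-transitive closure of $\xrightarrow{\hat\tau}$; $\overset{\hat\alpha}{\Longrightarrow}=\overset{\hat\tau}{\Longrightarrow}\xrightarrow{\hat\alpha}\overset{\hat\tau}{\Longrightarrow}$ for $\alpha\neq\tau$. A pseudoquasimetric is $d:\mathcal N\times\mathcal N\to[0,1]$ with $d(M,M)=0$ and the triangle inequality. $\Omega(\Delta,\Theta)$ is the set of matchings (distributions on pairs with marginals $\Delta,\Theta$); $\mathcal K(d)(\Delta,\Theta)=\min_{\omega\in\Omega(\Delta,\Theta)}\sum\omega(M,N)d(M,N)$. A weak simulation quasimetric is a pseudoquasimetric $d$ such that whenever $d(M,N)<1$ and $M\xrightarrow{\alpha}\Delta$ there is $\Theta$ with $N\overset{\hat\alpha}{\Longrightarrow}\Theta$ and $\mathcal K(d)(\Delta,\Theta+(1-|\Theta|)\overline\bot)\le d(M,N)$. $\mathbf m$ denotes the least weak simulation quasimetric (it exists), and $M\sqsubseteq_pN$ iff $\mathbf m(M,N)\le p$. Gossip processes with collisions: $\mathsf{snd}\langle u\rangle_p=\tau.({!}\langle u\rangle\oplus_p\mathsf{nil})$, $\mathsf{resndc}\langle u\rangle_p=\lfloor ?(x).\mathsf{nil}\rfloor\,\mathsf{snd}\langle u\rangle_p$, $\mathsf{fwdc}_p=?(x).\mathsf{resndc}\langle x\rangle_p$. *)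

theory Defs
  imports Complex_Main
begin

section \<open>Syntax of pTCWS\<close>

text \<open>Data terms: values or (data) variables, variables are natural numbers.\<close>
datatype 'v tm = Val 'v | Var nat

text \<open>Processes P and probabilistic choices C (a choice
  \<open>\<Oplus>\<^sub>i p\<^sub>i:P\<^sub>i\<close> is the list of pairs (p_i, P_i)).
  Out u C = !<u>.C ; In x C D = floor(?(x).C)D ; TauP C = tau.C ; Sleep C = sigma.C ;
  PVar X ; Fix X P.\<close>
datatype 'v proc =
    PNil
  | Out "'v tm" "(real \<times> 'v proc) list"
  | In nat "(real \<times> 'v proc) list" "(real \<times> 'v proc) list"
  | TauP "(real \<times> 'v proc) list"
  | Sleep "(real \<times> 'v proc) list"
  | PVar nat
  | Fix nat "'v proc"

type_synonym 'v chc = "(real \<times> 'v proc) list"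

datatype ('n, 'v) net =
    Zero
  | Par "('n, 'v) net" "('n, 'v) net"
  | Node 'n "'v proc" "'n set"
  | Bot

section \<open>Substitutions\<close>

fun tsub :: "nat \<Rightarrow> 'v \<Rightarrow> 'v tm \<Rightarrow> 'v tm" where
  "tsub x v (Val w) = Val w"
| "tsub x v (Var y) = (if y = x then Val v else Var y)"

text \<open>Value substitution P{v/x}; in In y C D the variable y is bound in C only.\<close>
primrec vsub :: "nat \<Rightarrow> 'v \<Rightarrow> 'v proc \<Rightarrow> 'v proc" where
  "vsub x v PNil = PNil"
| "vsub x v (Out u C) = Out (tsub x v u) (map (map_prod id (vsub x v)) C)"
| "vsub x v (In y C D) =
     In y (if y = x then C else map (map_prod id (vsub x v)) C)
          (map (map_prod id (vsub x v)) D)"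
| "vsub x v (TauP C) = TauP (map (map_prod id (vsub x v)) C)"
| "vsub x v (Sleep C) = Sleep (map (map_prod id (vsub x v)) C)"
| "vsub x v (PVar X) = PVar X"
| "vsub x v (Fix X P) = Fix X (vsub x v P)"

definition cvsub :: "nat \<Rightarrow> 'v \<Rightarrow> 'v chc \<Rightarrow> 'v chc" where
  "cvsub x v C = map (map_prod id (vsub x v)) C"

text \<open>Process substitution P{Q/X} (only used with closed Q, so no capture).\<close>
primrec psub :: "nat \<Rightarrow> 'v proc \<Rightarrow> 'v proc \<Rightarrow> 'v proc" where
  "psub X Q PNil = PNil"
| "psub X Q (Out u C) = Out u (map (map_prod id (psub X Q)) C)"
| "psub X Q (In y C D) =
     In y (map (map_prod id (psub X Q)) C) (map (map_prod id (psub X Q)) D)"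
| "psub X Q (TauP C) = TauP (map (map_prod id (psub X Q)) C)"
| "psub X Q (Sleep C) = Sleep (map (map_prod id (psub X Q)) C)"
| "psub X Q (PVar Y) = (if Y = X then Q else PVar Y)"
| "psub X Q (Fix Y P) = (if Y = X then Fix Y P else Fix Y (psub X Q P))"

section \<open>Well-formedness\<close>

text \<open>A probabilistic choice: finite non-empty, p_i in (0,1], summing to 1.\<close>
definition valid_chc :: "'v chc \<Rightarrow> bool" where
  "valid_chc C \<longleftrightarrow> C \<noteq> [] \<and> (\<forall>(p, Q)\<in>set C. 0 < p \<and> p \<le> 1) \<and> sum_list (map fst C) = 1"

definition tm_closed :: "nat set \<Rightarrow> 'v tm \<Rightarrow> bool" where
  "tm_closed B u \<longleftrightarrow> (\<forall>y. u = Var y \<longrightarrow> y \<in> B)"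

text \<open>wfp B G U P: data variables free in P lie in B; process variables free in P
  lie in G (bound and, at this position, time-guarded); variables in U are bound
  but not time-guarded at this position (so may not occur here); every choice is valid.\<close>
inductive wfp :: "nat set \<Rightarrow> nat set \<Rightarrow> nat set \<Rightarrow> 'v proc \<Rightarrow> bool" where
  wfp_nil: "wfp B G U PNil"
| wfp_out: "\<lbrakk> tm_closed B u; valid_chc C; \<forall>(p, Q)\<in>set C. wfp B G U Q \<rbrakk> \<Longrightarrow> wfp B G U (Out u C)"
| wfp_in: "\<lbrakk> valid_chc C; valid_chc D; \<forall>(p, Q)\<in>set C. wfp (insert x B) G U Q;
             \<forall>(p, Q)\<in>set D. wfp B (G \<union> U) {} Q \<rbrakk> \<Longrightarrow> wfp B G U (In x C D)"
| wfp_tau: "\<lbrakk> valid_chc C; \<forall>(p, Q)\<in>set C. wfp B G U Q \<rbrakk> \<Longrightarrow> wfp B G U (TauP C)"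
| wfp_sleep: "\<lbrakk> valid_chc C; \<forall>(p, Q)\<in>set C. wfp B (G \<union> U) {} Q \<rbrakk> \<Longrightarrow> wfp B G U (Sleep C)"
| wfp_var: "X \<in> G \<Longrightarrow> X \<notin> U \<Longrightarrow> wfp B G U (PVar X)"
| wfp_fix: "wfp B (G - {X}) (insert X U) P \<Longrightarrow> wfp B G U (Fix X P)"

text \<open>Closed, time-guarded process with valid choices.\<close>
definition wf_proc :: "'v proc \<Rightarrow> bool" where
  "wf_proc P \<longleftrightarrow> wfp {} {} {} P"

primrec nodes :: "('n, 'v) net \<Rightarrow> ('n \<times> 'v proc \<times> 'n set) list" where
  "nodes Zero = []"
| "nodes (Par M N) = nodes M @ nodes N"
| "nodes (Node n P \<nu>) = [(n, P, \<nu>)]"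
| "nodes Bot = []"

definition nds :: "('n, 'v) net \<Rightarrow> 'n set" where
  "nds M = set (map fst (nodes M))"

definition nbr_edges :: "('n, 'v) net \<Rightarrow> ('n \<times> 'n) set" where
  "nbr_edges M = {(n, m). \<exists>P \<nu>. (n, P, \<nu>) \<in> set (nodes M) \<and> m \<in> \<nu> \<and> m \<in> nds M}"

definition wf_net :: "('n, 'v) net \<Rightarrow> bool" where
  "wf_net M \<longleftrightarrow>
     distinct (map fst (nodes M))
   \<and> (\<forall>(n, P, \<nu>)\<in>set (nodes M). n \<notin> \<nu> \<and> wf_proc P)
   \<and> (\<forall>(n, P, \<nu>)\<in>set (nodes M). \<forall>(m, Q, \<mu>)\<in>set (nodes M). m \<in> \<nu> \<longleftrightarrow> n \<in> \<mu>)
   \<and> (\<forall>n\<in>nds M. \<forall>m\<in>nds M. (n, m) \<in> (nbr_edges M)\<^sup>*)"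

section \<open>Structural congruence\<close>

inductive scong :: "('n, 'v) net \<Rightarrow> ('n, 'v) net \<Rightarrow> bool" where
  sc_refl: "scong M M"
| sc_sym: "scong M N \<Longrightarrow> scong N M"
| sc_trans: "scong M N \<Longrightarrow> scong N K \<Longrightarrow> scong M K"
| sc_par: "scong M M' \<Longrightarrow> scong N N' \<Longrightarrow> scong (Par M N) (Par M' N')"
| sc_comm: "scong (Par M N) (Par N M)"
| sc_assoc: "scong (Par (Par M N) K) (Par M (Par N K))"
| sc_unit: "scong (Par M Zero) M"
| sc_fix: "scong (Node n (Fix X P) \<nu>) (Node n (psub X (Fix X P) P) \<nu>)"

text \<open>rcv(P): the node can receive in the current round.\<close>
definition rcv :: "'v proc \<Rightarrow> bool" where
  "rcv P \<longleftrightarrow> (\<forall>(n::unit) \<nu>. \<exists>x C D. scong (Node n P \<nu>) (Node n (In x C D) \<nu>))"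

text \<open>Iterated parallel composition over a finite index set.\<close>
definition nprod :: "nat set \<Rightarrow> (nat \<Rightarrow> ('n, 'v) net) \<Rightarrow> ('n, 'v) net" where
  "nprod I f = foldr (\<lambda>i M. Par (f i) M) (sorted_list_of_set I) Zero"

section \<open>Distributions\<close>

type_synonym ('n, 'v) dist = "('n, 'v) net \<Rightarrow> real"

definition dirac :: "('n, 'v) net \<Rightarrow> ('n, 'v) dist" where
  "dirac M = (\<lambda>N. if N = M then 1 else 0)"

definition den :: "'n \<Rightarrow> 'v chc \<Rightarrow> 'n set \<Rightarrow> ('n, 'v) dist" where
  "den n C \<nu> = (\<lambda>M. sum_list (map (\<lambda>(p, P). if M = Node n P \<nu> then p else 0) C))"

definition pard :: "('n, 'v) dist \<Rightarrow> ('n, 'v) dist \<Rightarrow> ('n, 'v) dist" where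
  "pard \<Delta> \<Theta> = (\<lambda>M. case M of Par M1 M2 \<Rightarrow> \<Delta> M1 * \<Theta> M2 | _ \<Rightarrow> 0)"

definition supp :: "('a \<Rightarrow> real) \<Rightarrow> 'a set" where
  "supp \<Delta> = {x. \<Delta> x \<noteq> 0}"

definition mass :: "('n, 'v) dist \<Rightarrow> real" where
  "mass \<Delta> = sum \<Delta> (supp \<Delta>)"

section \<open>Labelled transitions\<close>

datatype ('n, 'v) lab =
    LSnd 'n 'v "'n set"   \<comment> \<open>m!v|>nu\<close>
  | LObs 'v "'n set"      \<comment> \<open>!v|>nu\<close>
  | LRcv 'n 'v            \<comment> \<open>m?v\<close>
  | LTau
  | LSig

inductive trans :: "('n, 'v) net \<Rightarrow> ('n, 'v) lab \<Rightarrow> ('n, 'v) dist \<Rightarrow> bool" where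
  Snd: "trans (Node m (Out (Val v) C) \<nu>) (LSnd m v \<nu>) (den m C \<nu>)"
| Rcv: "m \<in> \<nu> \<Longrightarrow> trans (Node n (In x C D) \<nu>) (LRcv m v) (den n (cvsub x v C) \<nu>)"
| RcvZero: "trans Zero (LRcv m v) (dirac Zero)"
| RcvEnb: "\<lbrakk> \<not> (m \<in> \<nu> \<and> rcv P); m \<noteq> n \<rbrakk> \<Longrightarrow> trans (Node n P \<nu>) (LRcv m v) (dirac (Node n P \<nu>))"
| RcvPar: "\<lbrakk> trans M (LRcv m v) \<Delta>; trans N (LRcv m v) \<Theta> \<rbrakk> \<Longrightarrow> trans (Par M N) (LRcv m v) (pard \<Delta> \<Theta>)"
| BcastL: "\<lbrakk> trans M (LSnd m v \<nu>) \<Delta>; trans N (LRcv m v) \<Theta> \<rbrakk>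
            \<Longrightarrow> trans (Par M N) (LSnd m v (\<nu> - nds N)) (pard \<Delta> \<Theta>)"
| BcastR: "\<lbrakk> trans M (LSnd m v \<nu>) \<Delta>; trans N (LRcv m v) \<Theta> \<rbrakk>
            \<Longrightarrow> trans (Par N M) (LSnd m v (\<nu> - nds N)) (pard \<Theta> \<Delta>)"
| Tau: "trans (Node m (TauP C) \<nu>) LTau (den m C \<nu>)"
| TauParL: "\<lbrakk> trans M LTau \<Delta>; \<not> (\<exists>N'. scong N (Par Bot N')) \<rbrakk>
            \<Longrightarrow> trans (Par M N) LTau (pard \<Delta> (dirac N))"
| TauParR: "\<lbrakk> trans M LTau \<Delta>; \<not> (\<exists>N'. scong N (Par Bot N')) \<rbrakk>
            \<Longrightarrow> trans (Par N M) LTau (pard (dirac N) \<Delta>)"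
| SigZero: "trans Zero LSig (dirac Zero)"
| SigNil: "trans (Node n PNil \<nu>) LSig (dirac (Node n PNil \<nu>))"
| Timeout: "trans (Node n (In x C D) \<nu>) LSig (den n D \<nu>)"
| SleepR: "trans (Node n (Sleep C) \<nu>) LSig (den n C \<nu>)"
| SigPar: "\<lbrakk> trans M LSig \<Delta>; trans N LSig \<Theta> \<rbrakk> \<Longrightarrow> trans (Par M N) LSig (pard \<Delta> \<Theta>)"
| Rec: "trans (Node n (psub X (Fix X P) P) \<nu>) l \<Delta> \<Longrightarrow> trans (Node n (Fix X P) \<nu>) l \<Delta>"
| ShhSnd: "trans M (LSnd m v {}) \<Delta> \<Longrightarrow> trans M LTau \<Delta>"
| ObsSnd: "\<lbrakk> trans M (LSnd m v \<nu>) \<Delta>; \<nu> \<noteq> {} \<rbrakk> \<Longrightarrow> trans M (LObs v \<nu>) \<Delta>"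

text \<open>The labels alpha used in the simulation: !v|>nu, m?v, sigma, tau.\<close>
definition alpha_lab :: "('n, 'v) lab \<Rightarrow> bool" where
  "alpha_lab l \<longleftrightarrow> (\<exists>v \<nu>. l = LObs v \<nu>) \<or> (\<exists>m v. l = LRcv m v) \<or> l = LSig \<or> l = LTau"

section \<open>Weak transitions\<close>

definition hat_trans :: "('n, 'v) net \<Rightarrow> ('n, 'v) lab \<Rightarrow> ('n, 'v) dist \<Rightarrow> bool" where
  "hat_trans M l \<Delta> \<longleftrightarrow> (if l = LTau then trans M LTau \<Delta> \<or> \<Delta> = dirac M else trans M l \<Delta>)"

definition has_hat :: "('n, 'v) net \<Rightarrow> ('n, 'v) lab \<Rightarrow> bool" where
  "has_hat M l \<longleftrightarrow> (\<exists>\<Delta>. hat_trans M l \<Delta>)"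

text \<open>Lifting to distributions: Delta = sum_i p_i M_i (any finite decomposition with p_i > 0);
  the components with a hat-transition (a non-empty set J) move, the others are dropped.\<close>
definition lift_trans :: "('n, 'v) dist \<Rightarrow> ('n, 'v) lab \<Rightarrow> ('n, 'v) dist \<Rightarrow> bool" where
  "lift_trans \<Delta> l \<Theta> \<longleftrightarrow>
    (\<exists>xs :: (real \<times> ('n, 'v) net \<times> ('n, 'v) dist) list.
        (\<forall>(p, M, \<Theta>')\<in>set xs. 0 < p
            \<and> (has_hat M l \<longrightarrow> hat_trans M l \<Theta>')
            \<and> (\<not> has_hat M l \<longrightarrow> \<Theta>' = (\<lambda>_. 0)))
      \<and> (\<exists>(p, M, \<Theta>')\<in>set xs. has_hat M l)
      \<and> \<Delta> = (\<lambda>N. sum_list (map (\<lambda>(p, M, \<Theta>'). if M = N then p else 0) xs))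
      \<and> \<Theta> = (\<lambda>N. sum_list (map (\<lambda>(p, M, \<Theta>'). p * \<Theta>' N) xs)))"

definition wtau :: "('n, 'v) dist \<Rightarrow> ('n, 'v) dist \<Rightarrow> bool" where
  "wtau = (\<lambda>\<Delta> \<Theta>. lift_trans \<Delta> LTau \<Theta>)\<^sup>*\<^sup>*"

definition weak :: "('n, 'v) dist \<Rightarrow> ('n, 'v) lab \<Rightarrow> ('n, 'v) dist \<Rightarrow> bool" where
  "weak \<Delta> l \<Theta> \<longleftrightarrow>
    (if l = LTau then wtau \<Delta> \<Theta>
     else (\<exists>\<Delta>1 \<Delta>2. wtau \<Delta> \<Delta>1 \<and> lift_trans \<Delta>1 l \<Delta>2 \<and> wtau \<Delta>2 \<Theta>))"

section \<open>Kantorovich lifting and weak simulation quasimetrics\<close>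

definition matching :: "('n, 'v) dist \<Rightarrow> ('n, 'v) dist \<Rightarrow> (('n, 'v) net \<times> ('n, 'v) net \<Rightarrow> real) \<Rightarrow> bool" where
  "matching \<Delta> \<Theta> \<omega> \<longleftrightarrow>
     finite (supp \<omega>) \<and> (\<forall>z. 0 \<le> \<omega> z)
   \<and> (\<forall>M. \<Delta> M = sum (\<lambda>N. \<omega> (M, N)) {N. \<omega> (M, N) \<noteq> 0})
   \<and> (\<forall>N. \<Theta> N = sum (\<lambda>M. \<omega> (M, N)) {M. \<omega> (M, N) \<noteq> 0})"

definition kant :: "(('n, 'v) net \<Rightarrow> ('n, 'v) net \<Rightarrow> real) \<Rightarrow> ('n, 'v) dist \<Rightarrow> ('n, 'v) dist \<Rightarrow> real" where
  "kant d \<Delta> \<Theta> = Inf ((\<lambda>\<omega>. \<Sum>(M, N)\<in>supp \<omega>. \<omega> (M, N) * d M N) ` {\<omega>. matching \<Delta> \<Theta> \<omega>})"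

definition pseudoquasimetric :: "(('n, 'v) net \<Rightarrow> ('n, 'v) net \<Rightarrow> real) \<Rightarrow> bool" where
  "pseudoquasimetric d \<longleftrightarrow>
     (\<forall>M N. 0 \<le> d M N \<and> d M N \<le> 1) \<and> (\<forall>M. d M M = 0)
   \<and> (\<forall>M N K. d M K \<le> d M N + d N K)"

text \<open>Theta + (1 - |Theta|) bot\<close>
definition bot_complete :: "('n, 'v) dist \<Rightarrow> ('n, 'v) dist" where
  "bot_complete \<Theta> = (\<lambda>M. \<Theta> M + (1 - mass \<Theta>) * dirac Bot M)"

text \<open>The simulation condition is required on the space of well-formed networks.\<close>
definition weak_sim_qm :: "(('n, 'v) net \<Rightarrow> ('n, 'v) net \<Rightarrow> real) \<Rightarrow> bool" where
  "weak_sim_qm d \<longleftrightarrow> pseudoquasimetric d \<and>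
     (\<forall>M N l \<Delta>. wf_net M \<and> wf_net N \<and> d M N < 1 \<and> alpha_lab l \<and> trans M l \<Delta> \<longrightarrow>
        (\<exists>\<Theta>. weak (dirac N) l \<Theta> \<and> kant d \<Delta> (bot_complete \<Theta>) \<le> d M N))"

text \<open>The least weak simulation quasimetric (pointwise infimum).\<close>
definition mdist :: "('n, 'v) net \<Rightarrow> ('n, 'v) net \<Rightarrow> real" where
  "mdist M N = Inf {d M N | d. weak_sim_qm d}"

definition wsim :: "('n, 'v) net \<Rightarrow> real \<Rightarrow> ('n, 'v) net \<Rightarrow> bool" where
  "wsim M p N \<longleftrightarrow> mdist M N \<le> p"

section \<open>Gossip processes\<close>

text \<open>P (+)_p Q = p:P (+) (1-p):Q, collapsing a branch of probability 0.\<close>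
definition oplus :: "real \<Rightarrow> 'v proc \<Rightarrow> 'v proc \<Rightarrow> 'v chc" where
  "oplus p P Q = (if p = 1 then [(1, P)] else if p = 0 then [(1, Q)] else [(p, P), (1 - p, Q)])"

definition sndg :: "'v tm \<Rightarrow> real \<Rightarrow> 'v proc" where
  "sndg u p = TauP (oplus p (Out u [(1, PNil)]) PNil)"

definition resndc :: "'v tm \<Rightarrow> real \<Rightarrow> 'v proc" where
  "resndc u p = In 1 [(1, PNil)] [(1, sndg u p)]"

text \<open>?(x).C = fix X. floor(?(x).C)X with x = 0, X = 0.\<close>
definition fwdc :: "real \<Rightarrow> 'v proc" where
  "fwdc p = Fix 0 (In 0 [(1, resndc (Var 0) p)] [(1, PVar 0)])"

end

theory Submission
  imports Defs "HOL-Library.Multiset"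
begin

text \<open>
  Let \<open>L\<close> be the left-hand network. The least simulation quasimetric is bounded by any weak
  simulation quasimetric, and the following one suffices: distance \<open>0\<close> between structurally
  congruent networks, distance \<open>r\<close> from the class of \<open>L\<close> to the class of \<open>M\<close>, and distance \<open>1\<close>
  otherwise. On the zero-distance pairs the simulation condition says that structural congruence
  is a bisimulation. For the pairs at distance \<open>r\<close>, the network \<open>M\<close> silently resolves the coins
  of all senders \<open>m\<^sub>i\<close>; if exactly one of them decides to send, its broadcast reaches all
  \<open>n\<^sub>j\<close> and is hidden, so that \<open>M\<close> reaches \<open>L\<close> with probability \<open>1 - r\<close> by silent moves. From
  there any move of \<open>L\<close> can be copied, and the remaining mass \<open>r\<close> costs at most \<open>1\<close> per unit.
  If \<open>N\<close> contains the stuck network, the silent moves are blocked, but then \<open>L\<close> has no moves at all.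
\<close>

section \<open>Finitely supported weightings\<close>

text \<open>All winning senders lead to the same network: each sender ends as \<open>nil\<close>,
  whoever transmitted. The outcomes for different winners therefore add up, and \<open>1 - r\<close>
  is the probability that exactly one of the independent coins falls on sending. Runs with two or
  more pending senders are abandoned and counted as failures.

  What shapes the proof is that transitions match only up to structural congruence, and that
  networks along a run are not shown to be well-formed. The first point is met by comparing
  distributions through class functions and turning the result into a matching only at the end. The
  second is met by two weaker invariants: \<open>valid_net\<close> (all choices are probability
  distributions) and \<open>topology_ok\<close> (names and neighbourhoods), which makes hidden
  broadcasts compatible with associativity.

  Lower bounds on reaching probabilities are kept as derivation trees (\<open>reaches\<close>),
  which survive congruence; a weak transition is assembled from a tree only afterwards, because
  lifting a step to a distribution involves all its components.\<close>

definition expect :: "('a \<Rightarrow> real) \<Rightarrow> ('a \<Rightarrow> real) \<Rightarrow> real" where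
  "expect \<Delta> f = (\<Sum>x\<in>supp \<Delta>. \<Delta> x * f x)"

definition prob_dist :: "('a \<Rightarrow> real) \<Rightarrow> bool" where
  "prob_dist \<Delta> \<longleftrightarrow> finite (supp \<Delta>) \<and> (\<forall>x. 0 \<le> \<Delta> x) \<and> expect \<Delta> (\<lambda>_. 1) = 1"

text \<open>The monadic bind of weightings. \<open>F b\<close> need not have total weight 1:
  components dropped by a lifted transition are sent to the zero weighting.\<close>

definition mix :: "('b \<Rightarrow> real) \<Rightarrow> ('b \<Rightarrow> 'a \<Rightarrow> real) \<Rightarrow> 'a \<Rightarrow> real" where
  "mix \<Delta> F = (\<lambda>x. \<Sum>b\<in>supp \<Delta>. \<Delta> b * F b x)"

definition list_dist :: "(real \<times> 'a) list \<Rightarrow> 'a \<Rightarrow> real" where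
  "list_dist xs = (\<lambda>y. sum_list (map (\<lambda>(p, x). if y = x then p else 0) xs))"

lemma expect_superset:
  assumes "finite S" "supp \<Delta> \<subseteq> S"
  shows "expect \<Delta> f = (\<Sum>x\<in>S. \<Delta> x * f x)"
  unfolding expect_def
  by (rule sum.mono_neutral_left) (use assms in \<open>auto simp: supp_def\<close>)

lemma expect_cong: "(\<And>x. x \<in> supp \<Delta> \<Longrightarrow> f x = g x) \<Longrightarrow> expect \<Delta> f = expect \<Delta> g"
  unfolding expect_def by (auto intro: sum.cong)

lemma expect_mono:
  "(\<And>x. 0 \<le> \<Delta> x) \<Longrightarrow> (\<And>x. x \<in> supp \<Delta> \<Longrightarrow> f x \<le> g x) \<Longrightarrow> expect \<Delta> f \<le> expect \<Delta> g"
  unfolding expect_def by (auto intro!: sum_mono mult_left_mono)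

lemma supp_dirac [simp]: "supp (dirac M) = {M}"
  by (auto simp: supp_def dirac_def)

lemma expect_dirac [simp]: "expect (dirac M) f = f M"
  by (simp add: expect_def) (simp add: dirac_def)

lemma prob_dist_dirac [simp]: "prob_dist (dirac M)"
  by (auto simp: prob_dist_def) (auto simp: dirac_def)

lemma supp_list_dist: "supp (list_dist xs) \<subseteq> snd ` set xs"
proof
  fix y assume "y \<in> supp (list_dist xs)"
  moreover have "list_dist xs y = 0" if "y \<notin> snd ` set xs"
    using that unfolding list_dist_def by (induction xs) auto
  ultimately show "y \<in> snd ` set xs" by (auto simp: supp_def)
qed

lemma finite_supp_list_dist [simp]: "finite (supp (list_dist xs))"
  by (rule finite_subset[OF supp_list_dist]) simp

lemma expect_list_dist: "expect (list_dist xs) f = sum_list (map (\<lambda>(p, x). p * f x) xs)"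
proof -
  have "(\<Sum>y\<in>S. list_dist xs y * f y) = sum_list (map (\<lambda>(p, x). p * f x) xs)"
    if "finite S" "snd ` set xs \<subseteq> S" for S
    using that
  proof (induction xs)
    case Nil
    then show ?case by (simp add: list_dist_def)
  next
    case (Cons a xs)
    obtain p x where a: "a = (p, x)" by (cases a)
    have "list_dist (a # xs) y * f y = (if y = x then p * f y else 0) + list_dist xs y * f y" for y
      by (simp add: list_dist_def a algebra_simps)
    then show ?case using Cons by (simp add: sum.distrib a)
  qed
  then show ?thesis using expect_superset[OF _ supp_list_dist, of xs f] by simp
qed

lemma den_eq_list_dist: "den n C \<nu> = list_dist (map (\<lambda>(p, P). (p, Node n P \<nu>)) C)"
  by (rule ext) (induction C; auto simp: den_def list_dist_def)

lemma supp_pard: "supp (pard \<Delta> \<Theta>) = (\<lambda>(A, B). Par A B) ` (supp \<Delta> \<times> supp \<Theta>)"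
proof -
  have "M \<in> supp (pard \<Delta> \<Theta>) \<longleftrightarrow> M \<in> (\<lambda>(A, B). Par A B) ` (supp \<Delta> \<times> supp \<Theta>)" for M
    by (cases M) (auto simp: supp_def pard_def)
  then show ?thesis by blast
qed

text \<open>Fubini for the product of two weightings: \<open>Par\<close> is injective, so pairs of
  support elements and support networks correspond one to one.\<close>

lemma expect_pard:
  "expect (pard \<Delta> \<Theta>) f = expect \<Delta> (\<lambda>A. expect \<Theta> (\<lambda>B. f (Par A B)))"
proof -
  have "inj_on (\<lambda>(A, B). Par A B) (supp \<Delta> \<times> supp \<Theta>)" by (auto simp: inj_on_def)
  then have "expect (pard \<Delta> \<Theta>) f
      = (\<Sum>(A, B)\<in>supp \<Delta> \<times> supp \<Theta>. pard \<Delta> \<Theta> (Par A B) * f (Par A B))"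
    unfolding expect_def supp_pard by (simp add: sum.reindex split_def)
  also have "\<dots> = (\<Sum>A\<in>supp \<Delta>. \<Sum>B\<in>supp \<Theta>. \<Delta> A * \<Theta> B * f (Par A B))"
    by (simp add: sum.cartesian_product pard_def)
  also have "\<dots> = expect \<Delta> (\<lambda>A. expect \<Theta> (\<lambda>B. f (Par A B)))"
    unfolding expect_def by (simp add: sum_distrib_left mult.assoc)
  finally show ?thesis .
qed

lemma expect_swap:
  "expect \<Delta> (\<lambda>A. expect \<Theta> (\<lambda>B. f A B)) = expect \<Theta> (\<lambda>B. expect \<Delta> (\<lambda>A. f A B))"
  unfolding expect_def sum_distrib_left by (subst sum.swap) (simp add: mult.left_commute)

lemma pard_dirac: "pard (dirac M) (dirac N) = dirac (Par M N)"
  by (auto simp: fun_eq_iff pard_def dirac_def split: net.split)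

lemma pard_list_dist_dirac:
  "pard (list_dist xs) (dirac N) = list_dist (map (\<lambda>(p, B). (p, Par B N)) xs)"
proof
  fix M
  show "pard (list_dist xs) (dirac N) M = list_dist (map (\<lambda>(p, B). (p, Par B N)) xs) M"
    by (induction xs) (auto simp: list_dist_def pard_def dirac_def split: net.splits)
qed

lemma pard_dirac_list_dist:
  "pard (dirac N) (list_dist xs) = list_dist (map (\<lambda>(p, B). (p, Par N B)) xs)"
proof
  fix M
  show "pard (dirac N) (list_dist xs) M = list_dist (map (\<lambda>(p, B). (p, Par N B)) xs) M"
    by (induction xs) (auto simp: list_dist_def pard_def dirac_def split: net.splits)
qed

lemma prob_dist_pard: "prob_dist \<Delta> \<Longrightarrow> prob_dist \<Theta> \<Longrightarrow> prob_dist (pard \<Delta> \<Theta>)"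
  unfolding prob_dist_def expect_pard supp_pard by (auto simp: pard_def split: net.split)

lemma prob_dist_den:
  assumes "valid_chc C"
  shows "prob_dist (den n C \<nu>)"
proof -
  have "expect (den n C \<nu>) (\<lambda>_. 1) = 1"
    using assms unfolding den_eq_list_dist expect_list_dist
    by (simp add: o_def split_def valid_chc_def)
  moreover have "0 \<le> den n C \<nu> M" for M
    using assms unfolding den_def valid_chc_def by (intro sum_list_nonneg) (auto simp: less_imp_le)
  ultimately show ?thesis by (simp add: prob_dist_def den_eq_list_dist)
qed

lemma mass_eq_expect: "mass \<Delta> = expect \<Delta> (\<lambda>_. 1)"
  by (simp add: mass_def expect_def)

lemma bot_complete_prob_dist [simp]: "prob_dist \<Delta> \<Longrightarrow> bot_complete \<Delta> = \<Delta>"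
  by (simp add: bot_complete_def mass_eq_expect prob_dist_def)

lemma supp_mix: "supp (mix \<Delta> F) \<subseteq> (\<Union>b\<in>supp \<Delta>. supp (F b))"
proof
  fix x assume "x \<in> supp (mix \<Delta> F)"
  then have "(\<Sum>b\<in>supp \<Delta>. \<Delta> b * F b x) \<noteq> 0" by (simp add: supp_def mix_def)
  then obtain b where "b \<in> supp \<Delta>" "\<Delta> b * F b x \<noteq> 0" by (rule sum.not_neutral_contains_not_neutral)
  then show "x \<in> (\<Union>b\<in>supp \<Delta>. supp (F b))" by (auto simp: supp_def)
qed

lemma expect_mix:
  assumes "finite (supp \<Delta>)" "\<And>b. b \<in> supp \<Delta> \<Longrightarrow> finite (supp (F b))"
  shows "expect (mix \<Delta> F) f = expect \<Delta> (\<lambda>b. expect (F b) f)"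
proof -
  define S where "S = (\<Union>b\<in>supp \<Delta>. supp (F b))"
  have S: "finite S" unfolding S_def using assms by auto
  have "expect (mix \<Delta> F) f = (\<Sum>x\<in>S. \<Sum>b\<in>supp \<Delta>. \<Delta> b * F b x * f x)"
    using expect_superset[OF S] supp_mix[of \<Delta> F] by (simp add: S_def mix_def sum_distrib_right)
  also have "\<dots> = (\<Sum>b\<in>supp \<Delta>. \<Delta> b * (\<Sum>x\<in>S. F b x * f x))"
    by (subst sum.swap) (simp add: sum_distrib_left mult.assoc)
  also have "\<dots> = (\<Sum>b\<in>supp \<Delta>. \<Delta> b * expect (F b) f)"
    by (intro sum.cong refl arg_cong2[where f="(*)"] expect_superset[OF S, symmetric])
      (auto simp: S_def)
  finally show ?thesis by (simp add: expect_def)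
qed

lemma prob_dist_mix:
  assumes "prob_dist \<Delta>" "\<And>b. b \<in> supp \<Delta> \<Longrightarrow> prob_dist (F b)"
  shows "prob_dist (mix \<Delta> F)"
proof -
  have fin: "finite (supp \<Delta>)" "\<And>b. b \<in> supp \<Delta> \<Longrightarrow> finite (supp (F b))"
    using assms by (auto simp: prob_dist_def)
  have "finite (supp (mix \<Delta> F))"
    by (rule finite_subset[OF supp_mix]) (use fin in auto)
  moreover have "expect (mix \<Delta> F) (\<lambda>_. 1) = expect \<Delta> (\<lambda>_. 1)"
    by (subst expect_mix[OF fin], simp, rule expect_cong) (use assms in \<open>auto simp: prob_dist_def\<close>)
  ultimately show ?thesis
    using assms by (auto simp: prob_dist_def mix_def intro!: sum_nonneg)
qed

section \<open>Structural congruence\<close>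

text \<open>A recursive test for the side condition on the idle partner of a silent step, which in
  its original form quantifies over congruent networks.\<close>

primrec bot_free :: "('n, 'v) net \<Rightarrow> bool" where
  "bot_free Zero = True"
| "bot_free (Par M N) = (bot_free M \<and> bot_free N)"
| "bot_free (Node n P \<nu>) = True"
| "bot_free Bot = False"

lemma scong_bot_free: "scong M N \<Longrightarrow> bot_free M = bot_free N"
  by (induction rule: scong.induct) auto

lemma bot_free_iff: "bot_free N \<longleftrightarrow> \<not> (\<exists>N'. scong N (Par Bot N'))"
proof
  assume "bot_free N"
  then show "\<not> (\<exists>N'. scong N (Par Bot N'))" using scong_bot_free by fastforce
next
  have "\<not> bot_free N \<Longrightarrow> \<exists>N'. scong N (Par Bot N')"
  proof (induction N)
    case (Par M K)
    show ?case
    proof (cases "bot_free M")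
      case False
      with Par obtain N' where "scong M (Par Bot N')" by blast
      then have "scong (Par M K) (Par (Par Bot N') K)" by (intro sc_par sc_refl)
      then show ?thesis using sc_assoc sc_trans by blast
    next
      case True
      with Par obtain N' where "scong K (Par Bot N')" by auto
      then have "scong (Par K M) (Par (Par Bot N') M)" by (intro sc_par sc_refl)
      then show ?thesis using sc_assoc sc_trans sc_comm by blast
    qed
  next
    case Bot
    then show ?case using sc_sym[OF sc_unit] by blast
  qed auto
  then show "\<not> (\<exists>N'. scong N (Par Bot N')) \<Longrightarrow> bot_free N" by blast
qed

text \<open>Congruence alters a node only by unfolding or folding recursion, so the multiset of
  names with neighbourhoods is invariant. The communication graph is read off from it.\<close>

definition sites :: "('n, 'v) net \<Rightarrow> ('n \<times> 'n set) list" where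
  "sites M = map (\<lambda>(n, P, \<nu>). (n, \<nu>)) (nodes M)"

lemma sites_simps [simp]:
  "sites Zero = []" "sites (Par M N) = sites M @ sites N" "sites (Node n P \<nu>) = [(n, \<nu>)]"
  "sites Bot = []"
  by (auto simp: sites_def)

lemma nds_sites: "nds M = fst ` set (sites M)"
  by (force simp: nds_def sites_def)

lemma names_sites: "map fst (nodes M) = map fst (sites M)"
  by (auto simp: sites_def)

lemma scong_sites: "scong M N \<Longrightarrow> mset (sites M) = mset (sites N)"
  by (induction rule: scong.induct) auto

lemma nds_simps [simp]:
  "nds Zero = {}" "nds (Par M N) = nds M \<union> nds N" "nds (Node n P \<nu>) = {n}" "nds Bot = {}"
  by (auto simp: nds_sites)

lemma scong_nds: "scong M N \<Longrightarrow> nds M = nds N"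
  unfolding nds_sites using scong_sites mset_eq_setD by metis

lemma rcv_fix: "rcv (Fix X P) \<longleftrightarrow> rcv (psub X (Fix X P) P)"
  unfolding rcv_def using sc_trans sc_sym sc_fix by metis

text \<open>The fragment of \<open>wf_net\<close> that depends on \<open>sites\<close> alone and
  passes to both components of a parallel composition; connectedness would not survive the passage
  to a component.\<close>

definition topology_ok :: "('n, 'v) net \<Rightarrow> bool" where
  "topology_ok M \<longleftrightarrow> distinct (map fst (sites M))
     \<and> (\<forall>n \<nu>. (n, \<nu>) \<in> set (sites M) \<longrightarrow> n \<notin> \<nu>)
     \<and> (\<forall>n \<nu> m \<mu>. (n, \<nu>) \<in> set (sites M) \<longrightarrow> (m, \<mu>) \<in> set (sites M) \<longrightarrow> (m \<in> \<nu> \<longleftrightarrow> n \<in> \<mu>))"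

lemma topology_ok_scong:
  assumes "topology_ok M" "scong M N"
  shows "topology_ok N"
proof -
  have eq: "mset (sites M) = mset (sites N)" using assms(2) by (rule scong_sites)
  then have "mset (map fst (sites M)) = mset (map fst (sites N))" by simp
  then have d: "distinct (map fst (sites M)) \<longleftrightarrow> distinct (map fst (sites N))"
    by (rule mset_eq_imp_distinct_iff)
  have st: "set (sites M) = set (sites N)" using eq by (rule mset_eq_setD)
  show ?thesis using assms(1) unfolding topology_ok_def d st .
qed

lemma wf_net_topology_ok:
  assumes "wf_net M"
  shows "topology_ok M"
proof -
  have ex: "\<exists>P. (n, P, \<nu>) \<in> set (nodes M)" if "(n, \<nu>) \<in> set (sites M)" for n \<nu>
    using that by (auto simp: sites_def)
  have "n \<notin> \<nu>" if "(n, \<nu>) \<in> set (sites M)" for n \<nu>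
    using ex[OF that] assms unfolding wf_net_def by fast
  moreover have "m \<in> \<nu> \<longleftrightarrow> n \<in> \<mu>"
    if nm: "(n, \<nu>) \<in> set (sites M)" "(m, \<mu>) \<in> set (sites M)" for n \<nu> m \<mu>
    using ex[OF nm(1)] ex[OF nm(2)] assms unfolding wf_net_def by fast
  ultimately show ?thesis
    using assms unfolding topology_ok_def wf_net_def names_sites by blast
qed

lemma topology_ok_ParD: "topology_ok (Par M N) \<Longrightarrow> topology_ok M \<and> topology_ok N"
  unfolding topology_ok_def sites_simps map_append distinct_append set_append by blast

lemma topology_ok_sym:
  "topology_ok M \<Longrightarrow> (n, \<nu>) \<in> set (sites M) \<Longrightarrow> (m, \<mu>) \<in> set (sites M) \<Longrightarrow> m \<in> \<nu> \<longleftrightarrow> n \<in> \<mu>"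
  unfolding topology_ok_def by blast

section \<open>Validity of the probabilistic choices in processes and networks\<close>

lemma proc_list_induct [case_names PNil Out In TauP Sleep PVar Fix]:
  assumes "R PNil" "\<And>u C. (\<And>p P. (p, P) \<in> set C \<Longrightarrow> R P) \<Longrightarrow> R (Out u C)"
    "\<And>x C D. (\<And>p P. (p, P) \<in> set C \<Longrightarrow> R P) \<Longrightarrow> (\<And>p P. (p, P) \<in> set D \<Longrightarrow> R P) \<Longrightarrow> R (In x C D)"
    "\<And>C. (\<And>p P. (p, P) \<in> set C \<Longrightarrow> R P) \<Longrightarrow> R (TauP C)"
    "\<And>C. (\<And>p P. (p, P) \<in> set C \<Longrightarrow> R P) \<Longrightarrow> R (Sleep C)"
    "\<And>X. R (PVar X)" "\<And>X P. R P \<Longrightarrow> R (Fix X P)"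
  shows "R P"
  by (induction P) (use assms in \<open>fastforce intro: assms\<close>)+

text \<open>Primitive recursion through lists of pairs forces the detour via
  \<open>map_prod\<close>; \<open>valid_proc_simps\<close> restores the readable form. Only the
  choices are recorded, and substitution leaves their weights alone.\<close>

primrec valid_proc :: "'v proc \<Rightarrow> bool" where
  "valid_proc PNil = True"
| "valid_proc (Out u C) = (valid_chc C \<and> (\<forall>b\<in>set (map (map_prod id valid_proc) C). snd b))"
| "valid_proc (In x C D) = (valid_chc C \<and> (\<forall>b\<in>set (map (map_prod id valid_proc) C). snd b)
     \<and> valid_chc D \<and> (\<forall>b\<in>set (map (map_prod id valid_proc) D). snd b))"
| "valid_proc (TauP C) = (valid_chc C \<and> (\<forall>b\<in>set (map (map_prod id valid_proc) C). snd b))"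
| "valid_proc (Sleep C) = (valid_chc C \<and> (\<forall>b\<in>set (map (map_prod id valid_proc) C). snd b))"
| "valid_proc (PVar X) = True"
| "valid_proc (Fix X P) = valid_proc P"

definition valid_net :: "('n, 'v) net \<Rightarrow> bool" where
  "valid_net M \<longleftrightarrow> (\<forall>(n, P, \<nu>)\<in>set (nodes M). valid_proc P)"

lemma valid_net_simps [simp]:
  "valid_net Zero" "valid_net (Par M N) \<longleftrightarrow> valid_net M \<and> valid_net N"
  "valid_net (Node n P \<nu>) \<longleftrightarrow> valid_proc P" "valid_net Bot"
  by (force simp: valid_net_def)+

lemma valid_chc_map [simp]: "valid_chc (map (map_prod id f) C) \<longleftrightarrow> valid_chc C"
  by (auto simp: valid_chc_def o_def)

lemma ball_snd_map_prod:
  "(\<forall>b\<in>set (map (map_prod id f) C). snd b) \<longleftrightarrow> (\<forall>p P. (p, P) \<in> set C \<longrightarrow> f P)"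
  by force

lemmas valid_proc_simps = valid_proc.simps[unfolded ball_snd_map_prod]

declare valid_proc.simps [simp del] valid_proc_simps [simp]

lemma valid_proc_psub: "valid_proc P \<Longrightarrow> valid_proc Q \<Longrightarrow> valid_proc (psub X Q P)"
  by (induction P rule: proc_list_induct) auto

text \<open>Substitution copies the weights of every choice, so an invalid choice of
  \<open>P\<close> would still be visible in \<open>psub X Q P\<close>. Folding a recursion requires
  this direction.\<close>

lemma valid_proc_psubD: "valid_proc (psub X Q P) \<Longrightarrow> valid_proc P"
  by (induction P rule: proc_list_induct) (force split: if_splits)+

lemma valid_proc_vsub: "valid_proc P \<Longrightarrow> valid_proc (vsub x v P)"
  by (induction P rule: proc_list_induct) auto

lemma valid_proc_wfp: "Defs.wfp B G U P \<Longrightarrow> valid_proc P"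
  by (induction rule: Defs.wfp.induct) fastforce+

lemma valid_net_wf: "wf_net M \<Longrightarrow> valid_net M"
  using valid_proc_wfp by (fastforce simp: wf_net_def valid_net_def wf_proc_def)

lemma valid_net_scong: "scong M N \<Longrightarrow> valid_net M = valid_net N"
proof (induction rule: scong.induct)
  case (sc_fix n X P \<nu>)
  then show ?case using valid_proc_psub[of P "Fix X P"] valid_proc_psubD by auto
qed auto

section \<open>Structural congruence is a bisimulation\<close>

text \<open>
  The transition relation without \<open>ShhSnd\<close> and \<open>ObsSnd\<close>. Structural congruence is a bisimulation
  for it on all networks, whereas for the full relation associativity fails without a symmetric
  topology: a broadcast hidden inside \<open>M | N\<close> would have to be ignored by an outer component.
\<close>
inductive core :: "('n, 'v) net \<Rightarrow> ('n, 'v) lab \<Rightarrow> ('n, 'v) dist \<Rightarrow> bool" where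
  core_Snd: "core (Node m (Out (Val v) C) \<nu>) (LSnd m v \<nu>) (den m C \<nu>)"
| core_Rcv: "m \<in> \<nu> \<Longrightarrow> core (Node n (In x C D) \<nu>) (LRcv m v) (den n (cvsub x v C) \<nu>)"
| core_RcvZero: "core Zero (LRcv m v) (dirac Zero)"
| core_RcvEnb: "\<lbrakk> \<not> (m \<in> \<nu> \<and> rcv P); m \<noteq> n \<rbrakk> \<Longrightarrow> core (Node n P \<nu>) (LRcv m v) (dirac (Node n P \<nu>))"
| core_RcvPar: "\<lbrakk> core M (LRcv m v) \<Delta>; core N (LRcv m v) \<Theta> \<rbrakk> \<Longrightarrow> core (Par M N) (LRcv m v) (pard \<Delta> \<Theta>)"
| core_BcastL: "\<lbrakk> core M (LSnd m v \<nu>) \<Delta>; core N (LRcv m v) \<Theta>; \<mu> = \<nu> - nds N \<rbrakk>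
            \<Longrightarrow> core (Par M N) (LSnd m v \<mu>) (pard \<Delta> \<Theta>)"
| core_BcastR: "\<lbrakk> core M (LSnd m v \<nu>) \<Delta>; core N (LRcv m v) \<Theta>; \<mu> = \<nu> - nds N \<rbrakk>
            \<Longrightarrow> core (Par N M) (LSnd m v \<mu>) (pard \<Theta> \<Delta>)"
| core_Tau: "core (Node m (TauP C) \<nu>) LTau (den m C \<nu>)"
| core_TauParL: "\<lbrakk> core M LTau \<Delta>; bot_free N \<rbrakk> \<Longrightarrow> core (Par M N) LTau (pard \<Delta> (dirac N))"
| core_TauParR: "\<lbrakk> core M LTau \<Delta>; bot_free N \<rbrakk> \<Longrightarrow> core (Par N M) LTau (pard (dirac N) \<Delta>)"
| core_SigZero: "core Zero LSig (dirac Zero)"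
| core_SigNil: "core (Node n PNil \<nu>) LSig (dirac (Node n PNil \<nu>))"
| core_Timeout: "core (Node n (In x C D) \<nu>) LSig (den n D \<nu>)"
| core_Sleep: "core (Node n (Sleep C) \<nu>) LSig (den n C \<nu>)"
| core_SigPar: "\<lbrakk> core M LSig \<Delta>; core N LSig \<Theta> \<rbrakk> \<Longrightarrow> core (Par M N) LSig (pard \<Delta> \<Theta>)"
| core_Rec: "core (Node n (psub X (Fix X P) P) \<nu>) l \<Delta> \<Longrightarrow> core (Node n (Fix X P) \<nu>) l \<Delta>"

inductive_cases core_ParE: "core (Par M N) l \<Delta>"
inductive_cases core_ZeroE: "core Zero l \<Delta>"
inductive_cases core_FixE: "core (Node n (Fix X P) \<nu>) l \<Delta>"

inductive_cases core_Par_RcvE: "core (Par M N) (LRcv m v) \<Delta>"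
inductive_cases core_Par_SndE: "core (Par M N) (LSnd m v \<nu>) \<Delta>"
inductive_cases core_Par_TauE: "core (Par M N) LTau \<Delta>"
inductive_cases core_Par_SigE: "core (Par M N) LSig \<Delta>"

lemmas core_Par_cases = core_ParE [consumes 1, case_names Rcv SndL SndR TauL TauR Sig]
lemmas core_Fix_cases = core_FixE [consumes 1, case_names Rcv Unfold]

lemma core_trans: "core M l \<Delta> \<Longrightarrow> trans M l \<Delta>"
  by (induction rule: core.induct) (auto intro: trans.intros simp: bot_free_iff)

lemma core_bot_free: "core M l \<Delta> \<Longrightarrow> bot_free M"
  by (induction rule: core.induct) auto

lemma supp_den: "supp (den n C \<nu>) \<subseteq> (\<lambda>(p, P). Node n P \<nu>) ` set C"
  using supp_list_dist unfolding den_eq_list_dist by fastforce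

definition valid_dist :: "('n, 'v) dist \<Rightarrow> bool" where
  "valid_dist \<Delta> \<longleftrightarrow> prob_dist \<Delta> \<and> (\<forall>A\<in>supp \<Delta>. valid_net A)"

lemma valid_dist_dirac [simp]: "valid_dist (dirac M) \<longleftrightarrow> valid_net M"
  by (simp add: valid_dist_def)

lemma valid_dist_den:
  assumes "valid_chc C" "\<And>p P. (p, P) \<in> set C \<Longrightarrow> valid_proc P"
  shows "valid_dist (den n C \<nu>)"
  unfolding valid_dist_def
proof
  show "\<forall>A\<in>supp (den n C \<nu>). valid_net A"
  proof
    fix A assume "A \<in> supp (den n C \<nu>)"
    then obtain p P where "(p, P) \<in> set C" "A = Node n P \<nu>" using supp_den by fast
    then show "valid_net A" using assms(2) by simp
  qed
qed (simp add: prob_dist_den assms)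

lemma valid_dist_pard:
  assumes "valid_dist \<Delta>" "valid_dist \<Theta>"
  shows "valid_dist (pard \<Delta> \<Theta>)"
proof -
  have "\<forall>A\<in>supp (pard \<Delta> \<Theta>). valid_net A"
    unfolding supp_pard using assms by (simp add: valid_dist_def)
  then show ?thesis using assms by (simp add: valid_dist_def prob_dist_pard)
qed

lemma trans_valid: "trans M l \<Delta> \<Longrightarrow> valid_net M \<Longrightarrow> valid_dist \<Delta>"
proof (induction rule: trans.induct)
  case (Rcv m \<nu> n x C D v)
  then show ?case unfolding cvsub_def
    by (intro valid_dist_den) (auto intro: valid_proc_vsub)
next
  case (Rec n X P \<nu> l \<Delta>)
  then show ?case by (simp add: valid_proc_psub)
qed (auto intro: valid_dist_den valid_dist_pard)

section \<open>Equality of distributions modulo structural congruence\<close>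

definition scong_invariant :: "(('n, 'v) net \<Rightarrow> real) \<Rightarrow> bool" where
  "scong_invariant f \<longleftrightarrow> (\<forall>A B. scong A B \<longrightarrow> f A = f B)"

text \<open>
  Equality of expectations of class functions instead of matchings supported by structural
  congruence: it composes without gluing matchings.
\<close>
definition scong_equiv :: "('n, 'v) dist \<Rightarrow> ('n, 'v) dist \<Rightarrow> bool" where
  "scong_equiv \<Delta> \<Theta> \<longleftrightarrow> (\<forall>f. scong_invariant f \<longrightarrow> expect \<Delta> f = expect \<Theta> f)"

lemma scong_invariantD: "scong_invariant f \<Longrightarrow> scong A B \<Longrightarrow> f A = f B"
  by (auto simp: scong_invariant_def)

lemma scong_equiv_refl [simp]: "scong_equiv \<Delta> \<Delta>"
  by (simp add: scong_equiv_def)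

lemma scong_equiv_trans [trans]: "scong_equiv \<Delta> \<Theta> \<Longrightarrow> scong_equiv \<Theta> \<Psi> \<Longrightarrow> scong_equiv \<Delta> \<Psi>"
  by (simp add: scong_equiv_def)

lemma scong_equiv_dirac: "scong A B \<Longrightarrow> scong_equiv (dirac A) (dirac B)"
  by (simp add: scong_equiv_def scong_invariant_def)

text \<open>Two exchanges in the iterated expectation: the inner weighting is tested against
  \<open>f (Par A _)\<close>, and the resulting inner expectation is itself a class function of
  \<open>A\<close>.\<close>

lemma scong_equiv_pard:
  assumes "scong_equiv \<Delta> \<Delta>'" "scong_equiv \<Theta> \<Theta>'"
  shows "scong_equiv (pard \<Delta> \<Theta>) (pard \<Delta>' \<Theta>')"
  unfolding scong_equiv_def
proof (intro allI impI)
  fix f :: "('a, 'b) net \<Rightarrow> real" assume f: "scong_invariant f"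
  have "expect \<Theta> (\<lambda>B. f (Par A B)) = expect \<Theta>' (\<lambda>B. f (Par A B))" for A
    using assms(2) f unfolding scong_equiv_def scong_invariant_def by (meson sc_par sc_refl)
  moreover have "scong_invariant (\<lambda>A. expect \<Theta>' (\<lambda>B. f (Par A B)))"
    unfolding scong_invariant_def
    by (intro allI impI expect_cong scong_invariantD[OF f] sc_par sc_refl)
  ultimately show "expect (pard \<Delta> \<Theta>) f = expect (pard \<Delta>' \<Theta>') f"
    using assms(1) unfolding expect_pard scong_equiv_def by simp
qed

lemma scong_equiv_pard_comm: "scong_equiv (pard \<Delta> \<Theta>) (pard \<Theta> \<Delta>)"
  unfolding scong_equiv_def
proof (intro allI impI)
  fix f :: "('a, 'b) net \<Rightarrow> real" assume "scong_invariant f"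
  then have "f (Par A B) = f (Par B A)" for A B using sc_comm scong_invariantD by blast
  then show "expect (pard \<Delta> \<Theta>) f = expect (pard \<Theta> \<Delta>) f"
    unfolding expect_pard by (subst expect_swap) simp
qed

lemma scong_equiv_pard_assoc:
  "scong_equiv (pard (pard \<Delta> \<Theta>) \<Psi>) (pard \<Delta> (pard \<Theta> \<Psi>))"
  unfolding scong_equiv_def
proof (intro allI impI)
  fix f :: "('a, 'b) net \<Rightarrow> real" assume "scong_invariant f"
  then have "f (Par (Par A B) C) = f (Par A (Par B C))" for A B C
    using sc_assoc scong_invariantD by blast
  then show "expect (pard (pard \<Delta> \<Theta>) \<Psi>) f = expect (pard \<Delta> (pard \<Theta> \<Psi>)) f"
    unfolding expect_pard by simp
qed

lemma scong_equiv_pard_Zero: "scong_equiv (pard \<Delta> (dirac Zero)) \<Delta>"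
  unfolding scong_equiv_def
proof (intro allI impI)
  fix f :: "('a, 'b) net \<Rightarrow> real" assume "scong_invariant f"
  then have "f (Par A Zero) = f A" for A
    using sc_unit scong_invariantD by blast
  then show "expect (pard \<Delta> (dirac Zero)) f = expect \<Delta> f"
    unfolding expect_pard by simp
qed

lemma scong_equiv_sym: "scong_equiv \<Delta> \<Theta> \<Longrightarrow> scong_equiv \<Theta> \<Delta>"
  by (simp add: scong_equiv_def)

section \<open>The laws of structural congruence as simulations\<close>

definition core_sim :: "('n, 'v) net \<Rightarrow> ('n, 'v) net \<Rightarrow> bool" where
  "core_sim A B \<longleftrightarrow> (\<forall>l \<Delta>. core A l \<Delta> \<longrightarrow> (\<exists>\<Theta>. core B l \<Theta> \<and> scong_equiv \<Delta> \<Theta>))"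

lemma core_simD: "core_sim A B \<Longrightarrow> core A l \<Delta> \<Longrightarrow> \<exists>\<Theta>. core B l \<Theta> \<and> scong_equiv \<Delta> \<Theta>"
  by (auto simp: core_sim_def)

lemma core_sim_trans: "core_sim A B \<Longrightarrow> core_sim B C \<Longrightarrow> core_sim A C"
  unfolding core_sim_def using scong_equiv_trans by meson

text \<open>Congruence of the components is assumed beside simulation because the rules look at the
  partner directly: a broadcast label loses the \<open>nds\<close> of the listener, a silent step
  needs a \<open>bot_free\<close> partner, and an idle partner stays as a Dirac weighting.\<close>

lemma core_sim_par:
  assumes "core_sim M M'" "core_sim N N'" "scong M M'" "scong N N'"
  shows "core_sim (Par M N) (Par M' N')"
  unfolding core_sim_def
proof (intro allI impI)
  fix l \<Delta> assume "core (Par M N) l \<Delta>"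
  note M = core_simD[OF assms(1)] and N = core_simD[OF assms(2)]
  have eq: "nds M = nds M'" "nds N = nds N'" "bot_free M = bot_free M'" "bot_free N = bot_free N'"
    using assms(3,4) scong_nds scong_bot_free by blast+
  have dir: "scong_equiv (dirac M) (dirac M')" "scong_equiv (dirac N) (dirac N')"
    using assms by (auto intro: scong_equiv_dirac)
  from \<open>core (Par M N) l \<Delta>\<close> show "\<exists>\<Theta>. core (Par M' N') l \<Theta> \<and> scong_equiv \<Delta> \<Theta>"
  proof (cases rule: core_Par_cases)
    case (Rcv m v \<Delta>1 \<Delta>2)
    then show ?thesis using M N by (meson core.intros scong_equiv_pard)
  next
    case (SndL m v \<nu> \<Delta>1 \<Delta>2)
    then obtain \<Theta>1 \<Theta>2 where "core M' (LSnd m v \<nu>) \<Theta>1" "scong_equiv \<Delta>1 \<Theta>1"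
      "core N' (LRcv m v) \<Theta>2" "scong_equiv \<Delta>2 \<Theta>2" using M N by meson
    then show ?thesis using SndL eq core_BcastL scong_equiv_pard by metis
  next
    case (SndR m v \<nu> \<Delta>1 \<Delta>2)
    then obtain \<Theta>1 \<Theta>2 where "core N' (LSnd m v \<nu>) \<Theta>1" "scong_equiv \<Delta>1 \<Theta>1"
      "core M' (LRcv m v) \<Theta>2" "scong_equiv \<Delta>2 \<Theta>2" using M N by meson
    then show ?thesis using SndR eq core_BcastR scong_equiv_pard by metis
  next
    case (TauL \<Delta>')
    then show ?thesis using M eq dir by (meson core.intros scong_equiv_pard)
  next
    case (TauR \<Delta>')
    then show ?thesis using N eq dir by (meson core.intros scong_equiv_pard)
  next
    case (Sig \<Delta>1 \<Delta>2)
    then show ?thesis using M N by (meson core.intros scong_equiv_pard)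
  qed
qed

lemma core_sim_comm: "core_sim (Par M N) (Par N M)"
  unfolding core_sim_def
proof (intro allI impI)
  fix l \<Delta> assume "core (Par M N) l \<Delta>"
  then show "\<exists>\<Theta>. core (Par N M) l \<Theta> \<and> scong_equiv \<Delta> \<Theta>"
    by (cases rule: core_Par_cases) (blast intro: core.intros scong_equiv_pard_comm)+
qed

lemma core_sim_assoc: "core_sim (Par (Par M N) K) (Par M (Par N K))"
  unfolding core_sim_def
proof (intro allI impI)
  fix l \<Delta> assume "core (Par (Par M N) K) l \<Delta>"
  then show "\<exists>\<Theta>. core (Par M (Par N K)) l \<Theta> \<and> scong_equiv \<Delta> \<Theta>"
  proof (cases rule: core_Par_cases)
    case (Rcv m v \<Delta>1 \<Delta>2)
    then show ?thesis
      by (elim core_Par_RcvE) (blast intro: core_RcvPar scong_equiv_pard_assoc)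
  next
    case (SndL m v \<nu> \<Delta>1 \<Delta>2)
    from SndL(3) consider \<nu>' \<Delta>11 \<Delta>12 where "\<nu> = \<nu>' - nds N" "\<Delta>1 = pard \<Delta>11 \<Delta>12"
        "core M (LSnd m v \<nu>') \<Delta>11" "core N (LRcv m v) \<Delta>12"
      | \<nu>' \<Delta>11 \<Delta>12 where "\<nu> = \<nu>' - nds M" "\<Delta>1 = pard \<Delta>12 \<Delta>11"
        "core N (LSnd m v \<nu>') \<Delta>11" "core M (LRcv m v) \<Delta>12"
      by (elim core_Par_SndE) blast+
    then show ?thesis
    proof cases
      case 1
      \<comment> \<open>The residual audiences agree: removing \<open>nds N\<close> and then
        \<open>nds K\<close> is removing \<open>nds (Par N K)\<close>.\<close>
      have "core (Par M (Par N K)) l (pard \<Delta>11 (pard \<Delta>12 \<Delta>2))"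
        unfolding SndL(1)
        by (rule core_BcastL[OF 1(3) core_RcvPar[OF 1(4) SndL(4)]]) (use 1 in \<open>auto simp: nds_sites\<close>)
      then show ?thesis unfolding 1 SndL using scong_equiv_pard_assoc by blast
    next
      case 2
      have "core (Par M (Par N K)) l (pard \<Delta>12 (pard \<Delta>11 \<Delta>2))"
        unfolding SndL(1)
        by (rule core_BcastR[OF core_BcastL[OF 2(3) SndL(4) refl] 2(4)]) (use 2 in blast)
      then show ?thesis unfolding 2 SndL using scong_equiv_pard_assoc by blast
    qed
  next
    case (SndR m v \<nu> \<Delta>1 \<Delta>2)
    from SndR(4) obtain \<Delta>21 \<Delta>22 where *: "core M (LRcv m v) \<Delta>21" "core N (LRcv m v) \<Delta>22"
      "\<Delta>2 = pard \<Delta>21 \<Delta>22" by (elim core_Par_RcvE) blast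
    have "core (Par M (Par N K)) l (pard \<Delta>21 (pard \<Delta>22 \<Delta>1))"
      unfolding SndR(1)
      by (rule core_BcastR[OF core_BcastR[OF SndR(3) *(2) refl] *(1)]) (auto simp: nds_sites)
    then show ?thesis unfolding SndR * using scong_equiv_pard_assoc by blast
  next
    case (TauL \<Delta>')
    from TauL(3) consider \<Delta>1 where "core M LTau \<Delta>1" "\<Delta>' = pard \<Delta>1 (dirac N)" "bot_free N"
      | \<Delta>1 where "core N LTau \<Delta>1" "\<Delta>' = pard (dirac M) \<Delta>1" "bot_free M"
      by (elim core_Par_TauE) blast+
    then show ?thesis
    proof cases
      case 1
      then have "core (Par M (Par N K)) l (pard \<Delta>1 (dirac (Par N K)))"
        using TauL by (auto intro: core_TauParL)
      then show ?thesis unfolding 1 TauL pard_dirac[symmetric] using scong_equiv_pard_assoc by blast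
    next
      case 2
      then have "core (Par M (Par N K)) l (pard (dirac M) (pard \<Delta>1 (dirac K)))"
        using TauL by (auto intro: core_TauParL core_TauParR)
      then show ?thesis unfolding 2 TauL using scong_equiv_pard_assoc by blast
    qed
  next
    case (TauR \<Delta>')
    then have "core (Par M (Par N K)) l (pard (dirac M) (pard (dirac N) \<Delta>'))"
      by (auto intro: core_TauParR)
    then show ?thesis unfolding TauR pard_dirac[symmetric] using scong_equiv_pard_assoc by blast
  next
    case (Sig \<Delta>1 \<Delta>2)
    then show ?thesis
      by (elim core_Par_SigE) (blast intro: core_SigPar scong_equiv_pard_assoc)
  qed
qed

text \<open>The other direction of associativity follows by conjugating with commutativity.\<close>
lemma core_sim_assoc': "core_sim (Par M (Par N K)) (Par (Par M N) K)"
proof -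
  have refl: "core_sim A A" for A :: "('a, 'b) net" by (auto simp: core_sim_def)
  have "core_sim (Par M (Par N K)) (Par (Par K N) M)"
    by (rule core_sim_trans[OF core_sim_comm]) (intro core_sim_par core_sim_comm refl sc_comm sc_refl)
  also note core_sim_assoc
  finally (core_sim_trans) have "core_sim (Par M (Par N K)) (Par K (Par N M))" .
  moreover have "core_sim (Par K (Par N M)) (Par (Par M N) K)"
    by (rule core_sim_trans[OF core_sim_comm]) (intro core_sim_par core_sim_comm refl sc_comm sc_refl)
  ultimately show ?thesis by (rule core_sim_trans)
qed

lemma core_sim_unit: "core_sim (Par M Zero) M"
  unfolding core_sim_def
proof (intro allI impI)
  fix l \<Delta> assume "core (Par M Zero) l \<Delta>"
  then show "\<exists>\<Theta>. core M l \<Theta> \<and> scong_equiv \<Delta> \<Theta>"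
    by (cases rule: core_Par_cases)
      (auto elim!: core_ZeroE simp: nds_sites intro!: exI scong_equiv_pard_Zero)
qed

lemma core_not_LObs: "core M l \<Delta> \<Longrightarrow> l \<noteq> LObs v \<nu>"
  by (induction rule: core.induct) auto

lemma core_sim_unit': "core_sim M (Par M Zero)"
  unfolding core_sim_def
proof (intro allI impI)
  fix l \<Delta> assume *: "core M l \<Delta>"
  have "core (Par M Zero) l (pard \<Delta> (dirac Zero))"
  proof (cases l)
    case (LSnd m v \<nu>)
    then show ?thesis
      using * core_BcastL[of M m v \<nu> \<Delta> Zero "dirac Zero" \<nu>] by (auto simp: nds_sites core_RcvZero)
  qed (use * core_not_LObs[OF *] in \<open>auto intro: core.intros\<close>)
  then show "\<exists>\<Theta>. core (Par M Zero) l \<Theta> \<and> scong_equiv \<Delta> \<Theta>"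
    using scong_equiv_sym[OF scong_equiv_pard_Zero] by blast
qed

text \<open>Apart from \<open>core_Rec\<close>, only \<open>core_RcvEnb\<close> applies to a
  \<open>Fix\<close> node. There the unfolded node ignores the message too, as \<open>rcv\<close> is
  defined up to congruence, and the two Dirac targets are congruent.\<close>

lemma core_sim_fix: "core_sim (Node n (Fix X P) \<nu>) (Node n (psub X (Fix X P) P) \<nu>)"
  unfolding core_sim_def
proof (intro allI impI)
  fix l \<Delta> assume *: "core (Node n (Fix X P) \<nu>) l \<Delta>"
  then show "\<exists>\<Theta>. core (Node n (psub X (Fix X P) P) \<nu>) l \<Theta> \<and> scong_equiv \<Delta> \<Theta>"
  proof (cases rule: core_Fix_cases)
    case (Rcv m v)
    then have "core (Node n (psub X (Fix X P) P) \<nu>) l (dirac (Node n (psub X (Fix X P) P) \<nu>))"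
      using rcv_fix by (auto intro!: core_RcvEnb)
    then show ?thesis unfolding Rcv(2) using scong_equiv_dirac[OF scong.sc_fix[of n X P \<nu>]] by blast
  next
    case Unfold
    then show ?thesis by (auto intro: scong_equiv_refl)
  qed
qed

lemma scong_core_sim: "scong A B \<Longrightarrow> core_sim A B \<and> core_sim B A"
proof (induction rule: scong.induct)
  case (sc_refl M)
  then show ?case by (auto simp: core_sim_def)
next
  case (sc_trans M N K)
  then show ?case using core_sim_trans by blast
next
  case (sc_par M M' N N')
  then show ?case using core_sim_par scong.sc_sym by blast
next
  case (sc_fix n X P \<nu>)
  have "core_sim (Node n (psub X (Fix X P) P) \<nu>) (Node n (Fix X P) \<nu>)"
    unfolding core_sim_def by (blast intro: core_Rec scong_equiv_refl)
  then show ?case using core_sim_fix[of n X P \<nu>] by blast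
qed (auto intro: core_sim_comm core_sim_assoc core_sim_assoc' core_sim_unit core_sim_unit')

section \<open>Hidden broadcasts and the return to the full transition relation\<close>

definition silent :: "('n, 'v) net \<Rightarrow> ('n, 'v) dist \<Rightarrow> bool" where
  "silent M \<Delta> \<longleftrightarrow> core M LTau \<Delta> \<or> (\<exists>m v. core M (LSnd m v {}) \<Delta>)"

lemma silent_trans: "silent M \<Delta> \<Longrightarrow> trans M LTau \<Delta>"
  unfolding silent_def by (elim disjE exE; drule core_trans) (assumption, erule ShhSnd)

lemma silent_scong:
  assumes "scong A B" "silent A \<Delta>"
  shows "\<exists>\<Theta>. silent B \<Theta> \<and> scong_equiv \<Delta> \<Theta>"
proof -
  have "core_sim A B" using scong_core_sim[OF assms(1)] by blast
  then show ?thesis using assms(2) unfolding silent_def core_sim_def by blast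
qed

text \<open>The parallel rules delete from a broadcast label only names occurring in the network, so
  the neighbourhood of the sender is covered by the label together with
  \<open>nds M\<close>.\<close>

lemma core_snd_site:
  "core M l \<Delta> \<Longrightarrow> l = LSnd m v \<nu> \<Longrightarrow> \<exists>\<mu>. (m, \<mu>) \<in> set (sites M) \<and> \<mu> \<subseteq> \<nu> \<union> nds M"
proof (induction arbitrary: \<nu> rule: core.induct)
  case (core_BcastL M m' v' \<nu>' \<Delta> N \<Theta> \<mu>)
  from core_BcastL.prems core_BcastL.IH(1)[of \<nu>']
  obtain \<mu>' where "(m, \<mu>') \<in> set (sites M)" "\<mu>' \<subseteq> \<nu>' \<union> nds M" by auto
  then show ?case using core_BcastL.prems core_BcastL.hyps by (intro exI[of _ \<mu>']) auto
next
  case (core_BcastR M m' v' \<nu>' \<Delta> N \<Theta> \<mu>)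
  from core_BcastR.prems core_BcastR.IH(1)[of \<nu>']
  obtain \<mu>' where "(m, \<mu>') \<in> set (sites M)" "\<mu>' \<subseteq> \<nu>' \<union> nds M" by auto
  then show ?case using core_BcastR.prems core_BcastR.hyps by (intro exI[of _ \<mu>']) auto
qed auto

lemma core_ignore:
  assumes "bot_free N" "m \<notin> nds N" "\<And>k P \<nu>. (k, P, \<nu>) \<in> set (nodes N) \<Longrightarrow> \<not> (m \<in> \<nu> \<and> rcv P)"
  shows "core N (LRcv m v) (dirac N)"
  using assms
proof (induction N)
  case (Par M N)
  then have "core (Par M N) (LRcv m v) (pard (dirac M) (dirac N))"
    by (intro core_RcvPar Par.IH) auto
  then show ?case by (simp add: pard_dirac)
next
  case (Node n P \<nu>)
  then show ?case by (intro core_RcvEnb) auto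
qed (auto intro: core.intros)

text \<open>An empty label means that the whole neighbourhood of the sender lies inside
  \<open>M\<close>. Names are disjoint and neighbourhood is symmetric, so no node of
  \<open>N\<close> lists the sender as a neighbour.\<close>

lemma core_ignore_silent_snd:
  assumes "core M (LSnd m v {}) \<Delta>" "topology_ok (Par M N)" "bot_free N"
  shows "core N (LRcv m v) (dirac N)"
proof (rule core_ignore[OF assms(3)])
  obtain \<mu> where \<mu>: "(m, \<mu>) \<in> set (sites M)" "\<mu> \<subseteq> nds M"
    using core_snd_site[OF assms(1) refl] by auto
  have disj: "nds M \<inter> nds N = {}"
  proof -
    have "distinct (map fst (sites M) @ map fst (sites N))"
      using assms(2) unfolding topology_ok_def sites_simps map_append by blast
    then show ?thesis by (simp add: nds_sites)
  qed
  then show "m \<notin> nds N" using \<mu> by (force simp: nds_sites)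
  fix k P \<nu> assume "(k, P, \<nu>) \<in> set (nodes N)"
  then have k: "(k, \<nu>) \<in> set (sites N)" by (force simp: sites_def)
  then have "k \<notin> \<mu>" using \<mu> disj by (force simp: nds_sites)
  moreover have "m \<in> \<nu> \<longleftrightarrow> k \<in> \<mu>" using topology_ok_sym[OF assms(2), of m \<mu> k \<nu>] \<mu>(1) k by simp
  ultimately show "\<not> (m \<in> \<nu> \<and> rcv P)" by blast
qed

text \<open>Hiding can be postponed to the outermost position: where a hidden broadcast of one
  component passes through a parallel composition as a silent step, the same move is a broadcast
  that the other component ignores.\<close>

lemma trans_core:
  "trans M l \<Delta> \<Longrightarrow> topology_ok M \<Longrightarrow>
    (case l of LTau \<Rightarrow> silent M \<Delta> | LObs v \<nu> \<Rightarrow> \<nu> \<noteq> {} \<and> (\<exists>m. core M (LSnd m v \<nu>) \<Delta>)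
     | _ \<Rightarrow> core M l \<Delta>)"
proof (induction rule: trans.induct)
  case (RcvPar M m v \<Delta> N \<Theta>)
  then show ?case using topology_ok_ParD by (auto intro: core.intros)
next
  case (BcastL M m v \<nu> \<Delta> N \<Theta>)
  then show ?case using topology_ok_ParD by (auto intro: core.intros)
next
  case (BcastR M m v \<nu> \<Delta> N \<Theta>)
  then show ?case using topology_ok_ParD by (auto intro: core.intros)
next
  case (SigPar M \<Delta> N \<Theta>)
  then show ?case using topology_ok_ParD by (auto intro: core.intros)
next
  case (TauParL M \<Delta> N)
  have bf: "bot_free N" using TauParL by (simp add: bot_free_iff)
  have "silent M \<Delta>" using TauParL topology_ok_ParD by auto
  then consider "core M LTau \<Delta>" | m v where "core M (LSnd m v {}) \<Delta>"
    unfolding silent_def by blast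
  then have "silent (Par M N) (pard \<Delta> (dirac N))"
  proof cases
    case 1
    then show ?thesis using bf core_TauParL unfolding silent_def by blast
  next
    case 2
    have "core (Par M N) (LSnd m v {}) (pard \<Delta> (dirac N))"
      by (rule core_BcastL[OF 2 core_ignore_silent_snd[OF 2 TauParL.prems bf]]) simp
    then show ?thesis unfolding silent_def by blast
  qed
  then show ?case by simp
next
  case (TauParR M \<Delta> N)
  have bf: "bot_free N" using TauParR by (simp add: bot_free_iff)
  have top: "topology_ok (Par M N)" using TauParR.prems sc_comm topology_ok_scong by blast
  have "silent M \<Delta>" using TauParR topology_ok_ParD by auto
  then consider "core M LTau \<Delta>" | m v where "core M (LSnd m v {}) \<Delta>"
    unfolding silent_def by blast
  then have "silent (Par N M) (pard (dirac N) \<Delta>)"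
  proof cases
    case 1
    then show ?thesis using bf core_TauParR unfolding silent_def by blast
  next
    case 2
    have "core (Par N M) (LSnd m v {}) (pard (dirac N) \<Delta>)"
      by (rule core_BcastR[OF 2 core_ignore_silent_snd[OF 2 top bf]]) simp
    then show ?thesis unfolding silent_def by blast
  qed
  then show ?case by simp
next
  case (Rec n X P \<nu> l \<Delta>)
  have "topology_ok (Node n (psub X (Fix X P) P) \<nu>)" using Rec.prems by (simp add: topology_ok_def)
  from Rec.IH[OF this] show ?case by (cases l) (auto simp: silent_def intro: core.intros)
qed (auto simp: silent_def intro: core.intros)

lemma trans_scong:
  assumes "scong A B" "trans A l \<Delta>" "topology_ok A" "alpha_lab l"
  shows "\<exists>\<Theta>. trans B l \<Theta> \<and> scong_equiv \<Delta> \<Theta>"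
proof -
  note sim = core_simD[OF conjunct1[OF scong_core_sim[OF assms(1)]]]
  note core = trans_core[OF assms(2,3)]
  show ?thesis
  proof (cases l)
    case (LObs v \<nu>)
    then obtain m where "\<nu> \<noteq> {}" "core A (LSnd m v \<nu>) \<Delta>" using core by auto
    then show ?thesis using sim LObs core_trans ObsSnd by meson
  next
    case LTau
    then have "silent A \<Delta>" using core by simp
    then show ?thesis using silent_scong[OF assms(1)] silent_trans LTau by blast
  qed (use core sim core_trans in \<open>fastforce+\<close>)
qed

section \<open>Couplings\<close>

text \<open>An upper bound on the transport cost with an explicit witness. It avoids asking whether
  the infimum in \<open>kant\<close> is attained and lets witnesses be averaged.\<close>

definition coupled :: "(('n, 'v) net \<Rightarrow> ('n, 'v) net \<Rightarrow> real) \<Rightarrow> ('n, 'v) dist \<Rightarrow> ('n, 'v) dist \<Rightarrow> real \<Rightarrow> bool" where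
  "coupled d \<Delta> \<Theta> c \<longleftrightarrow> (\<exists>\<omega>. matching \<Delta> \<Theta> \<omega> \<and> expect \<omega> (\<lambda>(M, N). d M N) \<le> c)"

lemma kant_le:
  assumes "coupled d \<Delta> \<Theta> c" "\<And>M N. 0 \<le> d M N"
  shows "kant d \<Delta> \<Theta> \<le> c"
proof -
  let ?cost = "\<lambda>\<omega>. \<Sum>(M, N)\<in>supp \<omega>. \<omega> (M, N) * d M N"
  from assms(1) obtain \<omega> where \<omega>: "matching \<Delta> \<Theta> \<omega>" "expect \<omega> (\<lambda>(M, N). d M N) \<le> c"
    unfolding coupled_def by blast
  have "bdd_below (?cost ` {\<omega>. matching \<Delta> \<Theta> \<omega>})"
    by (rule bdd_belowI[of _ 0]) (auto simp: matching_def assms(2) intro!: sum_nonneg)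
  then have "kant d \<Delta> \<Theta> \<le> ?cost \<omega>"
    unfolding kant_def by (rule cInf_lower[rotated]) (use \<omega> in blast)
  also have "?cost \<omega> = expect \<omega> (\<lambda>(M, N). d M N)"
    by (simp add: expect_def split_def)
  finally show ?thesis using \<omega> by linarith
qed

lemma matchingI:
  assumes "finite S" "finite T" "supp \<omega> \<subseteq> S \<times> T" "\<And>z. 0 \<le> \<omega> z"
    "\<And>M. \<Delta> M = (\<Sum>N\<in>T. \<omega> (M, N))" "\<And>N. \<Theta> N = (\<Sum>M\<in>S. \<omega> (M, N))"
  shows "matching \<Delta> \<Theta> \<omega>"
  unfolding matching_def
proof (intro conjI allI)
  show "finite (supp \<omega>)" using finite_subset[OF assms(3)] assms(1,2) by simp
  show "0 \<le> \<omega> z" for z by (rule assms)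
  show "\<Delta> M = (\<Sum>N | \<omega> (M, N) \<noteq> 0. \<omega> (M, N))" for M
    unfolding assms(5)
    by (rule sum.mono_neutral_right) (use assms(1-3) in \<open>auto simp: supp_def\<close>)
  show "\<Theta> N = (\<Sum>M | \<omega> (M, N) \<noteq> 0. \<omega> (M, N))" for N
    unfolding assms(6)
    by (rule sum.mono_neutral_right) (use assms(1-3) in \<open>auto simp: supp_def\<close>)
qed

lemma matching_marginals:
  assumes "matching \<Delta> \<Theta> \<omega>" "finite S" "finite T" "supp \<omega> \<subseteq> S \<times> T"
  shows "\<Delta> M = (\<Sum>N\<in>T. \<omega> (M, N))" "\<Theta> N = (\<Sum>M\<in>S. \<omega> (M, N))"
proof -
  have "\<Delta> M = (\<Sum>N | \<omega> (M, N) \<noteq> 0. \<omega> (M, N))" using assms(1) by (simp add: matching_def)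
  also have "\<dots> = (\<Sum>N\<in>T. \<omega> (M, N))"
    by (rule sum.mono_neutral_left) (use assms(2-4) in \<open>auto simp: supp_def\<close>)
  finally show "\<Delta> M = (\<Sum>N\<in>T. \<omega> (M, N))" .
  have "\<Theta> N = (\<Sum>M | \<omega> (M, N) \<noteq> 0. \<omega> (M, N))" using assms(1) by (simp add: matching_def)
  also have "\<dots> = (\<Sum>M\<in>S. \<omega> (M, N))"
    by (rule sum.mono_neutral_left) (use assms(2-4) in \<open>auto simp: supp_def\<close>)
  finally show "\<Theta> N = (\<Sum>M\<in>S. \<omega> (M, N))" .
qed

text \<open>Convexity of the transport cost in the second argument: the \<Psi>-average of the
  matchings is a matching, and its first marginal is still \<Delta> because the weights of \<Psi>
  sum to 1.\<close>

lemma coupled_mix: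
  assumes \<Psi>: "prob_dist \<Psi>" and c: "\<And>B. B \<in> supp \<Psi> \<Longrightarrow> coupled d \<Delta> (F B) (c B)"
  shows "coupled d \<Delta> (mix \<Psi> F) (expect \<Psi> c)"
proof -
  have "\<forall>B. \<exists>\<omega>. B \<in> supp \<Psi> \<longrightarrow> matching \<Delta> (F B) \<omega> \<and> expect \<omega> (\<lambda>(M, N). d M N) \<le> c B"
    using c unfolding coupled_def by blast
  then obtain w where w: "\<And>B. B \<in> supp \<Psi> \<Longrightarrow> matching \<Delta> (F B) (w B)"
    "\<And>B. B \<in> supp \<Psi> \<Longrightarrow> expect (w B) (\<lambda>(M, N). d M N) \<le> c B"
    by metis
  have fin: "finite (supp \<Psi>)" "\<And>B. B \<in> supp \<Psi> \<Longrightarrow> finite (supp (w B))"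
    using \<Psi> w(1) by (auto simp: prob_dist_def matching_def)
  \<comment> \<open>One finite rectangle containing all supports, so that sums over marginals can be
    exchanged with the sum over \<Psi>.\<close>
  define U where "U = (\<Union>B\<in>supp \<Psi>. supp (w B))"
  define S T where "S = fst ` U" and "T = snd ` U"
  have ST: "finite S" "finite T" "\<And>B. B \<in> supp \<Psi> \<Longrightarrow> supp (w B) \<subseteq> S \<times> T"
    using fin unfolding S_def T_def U_def by force+
  have mixsub: "supp (mix \<Psi> w) \<subseteq> S \<times> T"
    using supp_mix[of \<Psi> w] ST(3) by blast
  have "matching \<Delta> (mix \<Psi> F) (mix \<Psi> w)"
  proof (rule matchingI[OF ST(1,2) mixsub])
    have "0 \<le> w B z" if "B \<in> supp \<Psi>" for B z
      using w(1)[OF that] unfolding matching_def by blast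
    then show "0 \<le> mix \<Psi> w z" for z
      using \<Psi> unfolding mix_def prob_dist_def by (intro sum_nonneg mult_nonneg_nonneg) auto
    show "\<Delta> M = (\<Sum>N\<in>T. mix \<Psi> w (M, N))" for M
    proof -
      have "\<Psi> B * \<Delta> M = (\<Sum>N\<in>T. \<Psi> B * w B (M, N))" if "B \<in> supp \<Psi>" for B
        using matching_marginals(1)[OF w(1)[OF that] ST(1,2) ST(3)[OF that], of M]
        by (simp add: sum_distrib_left)
      then have "(\<Sum>N\<in>T. mix \<Psi> w (M, N)) = (\<Sum>B\<in>supp \<Psi>. \<Psi> B * \<Delta> M)"
        unfolding mix_def by (subst sum.swap) simp
      also have "\<dots> = expect \<Psi> (\<lambda>_. 1) * \<Delta> M" by (simp add: expect_def sum_distrib_right)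
      finally show ?thesis using \<Psi> by (simp add: prob_dist_def)
    qed
    show "mix \<Psi> F N = (\<Sum>M\<in>S. mix \<Psi> w (M, N))" for N
    proof -
      have "\<Psi> B * F B N = (\<Sum>M\<in>S. \<Psi> B * w B (M, N))" if "B \<in> supp \<Psi>" for B
        using matching_marginals(2)[OF w(1)[OF that] ST(1,2) ST(3)[OF that], of N]
        by (simp add: sum_distrib_left)
      then show ?thesis
        unfolding mix_def by (subst sum.swap) simp
    qed
  qed
  moreover have "expect (mix \<Psi> w) (\<lambda>(M, N). d M N) \<le> expect \<Psi> c"
    by (subst expect_mix[OF fin], assumption, rule expect_mono)
      (use \<Psi> w(2) in \<open>auto simp: prob_dist_def\<close>)
  ultimately show ?thesis unfolding coupled_def by blast
qed

lemma coupled_one: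
  assumes "prob_dist \<Delta>" "prob_dist \<Theta>" "\<And>M N. d M N \<le> 1"
  shows "coupled d \<Delta> \<Theta> 1"
proof -
  define \<omega> where "\<omega> = (\<lambda>(M, N). \<Delta> M * \<Theta> N)"
  have S: "finite (supp \<Delta>)" "finite (supp \<Theta>)" "supp \<omega> \<subseteq> supp \<Delta> \<times> supp \<Theta>"
    using assms by (auto simp: prob_dist_def \<omega>_def supp_def)
  have one: "sum \<Delta> (supp \<Delta>) = 1" "sum \<Theta> (supp \<Theta>) = 1"
    using assms by (auto simp: prob_dist_def expect_def)
  have nonneg: "0 \<le> \<omega> z" for z using assms by (auto simp: prob_dist_def \<omega>_def split: prod.split)
  have "matching \<Delta> \<Theta> \<omega>"
    by (rule matchingI[OF S nonneg])
      (simp_all add: \<omega>_def one flip: sum_distrib_left sum_distrib_right)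
  moreover have "expect \<omega> (\<lambda>(M, N). d M N) \<le> 1"
  proof -
    have "expect \<omega> (\<lambda>(M, N). d M N) \<le> expect \<omega> (\<lambda>_. 1)"
      by (rule expect_mono) (use nonneg assms(3) in auto)
    also have "\<dots> = (\<Sum>(M, N)\<in>supp \<Delta> \<times> supp \<Theta>. \<Delta> M * \<Theta> N)"
      using expect_superset[OF _ S(3)] S(1,2) by (simp add: \<omega>_def split_def)
    also have "\<dots> = 1"
      by (simp add: one flip: sum.cartesian_product sum_distrib_left)
    finally show ?thesis .
  qed
  ultimately show ?thesis unfolding coupled_def by blast
qed

text \<open>Tested against the indicator of a class, equality of expectations says that both
  weightings give every congruence class the same mass. Each class can then be matched with itself
  at distance 0.\<close>

lemma coupled_scong_equiv:
  fixes \<Delta> \<Theta> :: "('n, 'v) dist"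
  assumes "prob_dist \<Delta>" "prob_dist \<Theta>" "scong_equiv \<Delta> \<Theta>" "\<And>M N. scong M N \<Longrightarrow> d M N = 0"
  shows "coupled d \<Delta> \<Theta> 0"
proof -
  define ind :: "('n, 'v) net \<Rightarrow> ('n, 'v) net \<Rightarrow> real" where "ind M N = (if scong M N then 1 else 0)" for M N
  have ind_cong: "ind M N = ind M' N'" if "scong M M'" "scong N N'" for M M' N N'
    unfolding ind_def using that sc_trans sc_sym by metis
  have ind_sym: "ind M N = ind N M" for M N unfolding ind_def using sc_sym by metis
  define cls where "cls M = expect \<Delta> (ind M)" for M
  have cls_eq: "cls M = expect \<Theta> (ind M)" for M
  proof -
    have "scong_invariant (ind M)" unfolding scong_invariant_def using ind_cong sc_refl by blast
    then show ?thesis using assms(3) by (simp add: cls_def scong_equiv_def)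
  qed
  have fin: "finite (supp \<Delta>)" "finite (supp \<Theta>)" and nonneg: "\<And>M. 0 \<le> \<Delta> M" "\<And>M. 0 \<le> \<Theta> M"
    using assms(1,2) by (auto simp: prob_dist_def)
  have cls_ge: "\<Delta> M \<le> cls M" "\<Theta> M \<le> cls M" for M
  proof -
    have le: "\<Psi> M \<le> expect \<Psi> (ind M)" if "finite (supp \<Psi>)" "\<And>M. 0 \<le> \<Psi> M"
      for \<Psi> :: "('n, 'v) dist"
    proof (cases "M \<in> supp \<Psi>")
      case True
      then have "\<Psi> M * ind M M \<le> expect \<Psi> (ind M)" unfolding expect_def
        using that by (intro member_le_sum) (auto simp: ind_def)
      then show ?thesis by (simp add: ind_def sc_refl)
    next
      case False
      then show ?thesis using that unfolding expect_def
        by (auto simp: supp_def ind_def intro!: sum_nonneg)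
    qed
    show "\<Delta> M \<le> cls M" unfolding cls_def by (rule le) (use fin nonneg in auto)
    show "\<Theta> M \<le> cls M" unfolding cls_eq by (rule le) (use fin nonneg in auto)
  qed
  have cls_cong: "cls M = cls N" if "scong M N" for M N
    unfolding cls_def by (rule expect_cong) (use that ind_cong sc_refl in blast)
  \<comment> \<open>the independent coupling within each congruence class\<close>
  define \<omega> where "\<omega> = (\<lambda>(M, N). \<Delta> M * \<Theta> N * ind M N / cls M)"
  have S: "supp \<omega> \<subseteq> supp \<Delta> \<times> supp \<Theta>" by (auto simp: \<omega>_def supp_def)
  have \<omega>_nonneg: "0 \<le> \<omega> z" for z
    using nonneg cls_ge order_trans[OF nonneg(1) cls_ge(1)] by (auto simp: \<omega>_def ind_def split: prod.split)
  have "matching \<Delta> \<Theta> \<omega>"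
  proof (rule matchingI[OF fin S \<omega>_nonneg])
    show "\<Delta> M = (\<Sum>N\<in>supp \<Theta>. \<omega> (M, N))" for M
    proof -
      have "(\<Sum>N\<in>supp \<Theta>. \<omega> (M, N)) = \<Delta> M * expect \<Theta> (ind M) / cls M"
        by (simp add: \<omega>_def expect_def sum_distrib_left sum_divide_distrib mult.assoc)
      \<comment> \<open>If \<open>cls M\<close> is 0, the division yields 0, and
        \<open>cls_ge\<close> forces \<Delta> M to be 0 as well.\<close>
      also have "\<dots> = \<Delta> M"
        using cls_ge(1)[of M] nonneg(1)[of M] by (cases "cls M = 0") (auto simp: cls_eq)
      finally show ?thesis by simp
    qed
    show "\<Theta> N = (\<Sum>M\<in>supp \<Delta>. \<omega> (M, N))" for N
    proof -
      \<comment> \<open>Inside a class the normaliser \<open>cls M\<close> equals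
        \<open>cls N\<close>, which does not depend on the summation index.\<close>
      have "\<omega> (M, N) = \<Theta> N * (\<Delta> M * ind N M) / cls N" for M
      proof (cases "scong M N")
        case True
        then show ?thesis using cls_cong[OF True] ind_sym[of M N] by (simp add: \<omega>_def ind_def)
      next
        case False
        then show ?thesis using ind_sym[of M N] by (simp add: \<omega>_def ind_def)
      qed
      then have "(\<Sum>M\<in>supp \<Delta>. \<omega> (M, N)) = \<Theta> N * expect \<Delta> (ind N) / cls N"
        by (simp add: expect_def sum_distrib_left sum_divide_distrib)
      also have "\<dots> = \<Theta> N"
        using cls_ge(2)[of N] nonneg(2)[of N] by (cases "cls N = 0") (auto simp: cls_def)
      finally show ?thesis by simp
    qed
  qed
  moreover have "expect \<omega> (\<lambda>(M, N). d M N) = 0"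
    unfolding expect_def by (rule sum.neutral) (use assms(4) in \<open>auto simp: \<omega>_def ind_def\<close>)
  ultimately show ?thesis unfolding coupled_def by fastforce
qed

section \<open>Weak transitions\<close>

text \<open>The decomposition lists each support element once with its own weight; \<open>F\<close>
  collects the chosen responses, zero where none exists.\<close>

lemma lift_transI:
  assumes "finite (supp \<Delta>)" "\<And>B. 0 \<le> \<Delta> B"
    and "\<And>B. B \<in> supp \<Delta> \<Longrightarrow> has_hat B l \<Longrightarrow> hat_trans B l (F B)"
    and "\<And>B. B \<in> supp \<Delta> \<Longrightarrow> \<not> has_hat B l \<Longrightarrow> F B = (\<lambda>_. 0)"
    and "\<exists>B\<in>supp \<Delta>. has_hat B l"
  shows "lift_trans \<Delta> l (mix \<Delta> F)"
proof -
  obtain bs where bs: "set bs = supp \<Delta>" "distinct bs"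
    using finite_distinct_list[OF assms(1)] by blast
  define xs where "xs = map (\<lambda>B. (\<Delta> B, B, F B)) bs"
  have "\<Delta> = (\<lambda>N. sum_list (map (\<lambda>(p, M, \<Theta>'). if M = N then p else 0) xs))"
  proof
    fix N
    have "sum_list (map (\<lambda>(p, M, \<Theta>'). if M = N then p else 0) xs)
        = (\<Sum>B\<in>supp \<Delta>. if B = N then \<Delta> B else 0)"
      using bs by (simp add: xs_def o_def sum_list_distinct_conv_sum_set)
    also have "\<dots> = \<Delta> N" using assms(1) by (simp add: supp_def)
    finally show "\<Delta> N = sum_list (map (\<lambda>(p, M, \<Theta>'). if M = N then p else 0) xs)" by simp
  qed
  moreover have "mix \<Delta> F = (\<lambda>N. sum_list (map (\<lambda>(p, M, \<Theta>'). p * \<Theta>' N) xs))"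
    using bs by (simp add: xs_def o_def mix_def sum_list_distinct_conv_sum_set)
  moreover have "0 < \<Delta> B" if "B \<in> supp \<Delta>" for B
    using that assms(2)[of B] by (simp add: supp_def)
  ultimately show ?thesis
    unfolding lift_trans_def using assms(3-5) bs(1)
    by (intro exI[of _ xs]) (auto simp: xs_def)
qed

lemma has_hat_tau [simp]: "has_hat M LTau"
  by (auto simp: has_hat_def hat_trans_def)

lemma dirac_nonneg: "0 \<le> dirac M N"
  by (simp add: dirac_def)

lemma mix_dirac_left [simp]: "mix (dirac M) F = F M"
  by (simp add: mix_def) (simp add: dirac_def)

lemma wtau_trans: "trans M LTau \<Delta> \<Longrightarrow> wtau (dirac M) \<Delta>"
proof -
  assume "trans M LTau \<Delta>"
  then have "lift_trans (dirac M) LTau (mix (dirac M) (\<lambda>_. \<Delta>))"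
    by (intro lift_transI) (auto simp: hat_trans_def dirac_nonneg)
  then show ?thesis unfolding wtau_def by (simp only: mix_dirac_left) blast
qed

text \<open>Each component of the remainder \<open>R\<close> idles by the reflexive part of the
  hatted silent step. Decompositions are lists and may repeat networks, so overlap between the
  supports of \<open>X\<close> and \<open>R\<close> does no harm.\<close>

lemma lift_trans_frame:
  assumes "lift_trans X LTau Y" "0 < p" "finite (supp R)" "\<And>B. 0 \<le> R B"
  shows "lift_trans (\<lambda>A. p * X A + R A) LTau (\<lambda>A. p * Y A + R A)"
proof -
  from assms(1) obtain xs where xs: "\<forall>(p, M, \<Theta>')\<in>set xs. 0 < p \<and> hat_trans M LTau \<Theta>'"
    "xs \<noteq> []"
    "X = (\<lambda>N. sum_list (map (\<lambda>(p, M, \<Theta>'). if M = N then p else 0) xs))"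
    "Y = (\<lambda>N. sum_list (map (\<lambda>(p, M, \<Theta>'). p * \<Theta>' N) xs))"
    unfolding lift_trans_def by fastforce
  obtain bs where bs: "set bs = supp R" "distinct bs"
    using finite_distinct_list[OF assms(3)] by blast
  define ys where "ys = map (\<lambda>(q, z). (p * q, z)) xs @ map (\<lambda>B. (R B, B, dirac B)) bs"
  have R: "sum_list (map (\<lambda>B. if B = N then R B else 0) bs) = R N"
    "sum_list (map (\<lambda>B. R B * dirac B N) bs) = R N" for N
  proof -
    have "sum_list (map (\<lambda>B. if B = N then R B else 0) bs) = (\<Sum>B\<in>supp R. if B = N then R B else 0)"
      using bs by (simp add: sum_list_distinct_conv_sum_set)
    also have "\<dots> = R N" using assms(3) by (simp add: supp_def)
    finally show *: "sum_list (map (\<lambda>B. if B = N then R B else 0) bs) = R N" .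
    have "(\<lambda>B. R B * dirac B N) = (\<lambda>B. if B = N then R B else 0)"
      by (auto simp: dirac_def)
    then show "sum_list (map (\<lambda>B. R B * dirac B N) bs) = R N" using * by simp
  qed
  have 1: "(\<Sum>(q, M, \<Theta>')\<leftarrow>map (\<lambda>(q, z). (p * q, z)) zs. if M = N then q else 0)
      = p * (\<Sum>(q, M, \<Theta>')\<leftarrow>zs. if M = N then q else 0)"
    for N and zs :: "(real \<times> ('a, 'b) net \<times> ('a, 'b) dist) list"
    by (induction zs) (auto simp: algebra_simps)
  have 2: "(\<Sum>(q, M, \<Theta>')\<leftarrow>map (\<lambda>(q, z). (p * q, z)) zs. q * \<Theta>' N)
      = p * (\<Sum>(q, M, \<Theta>')\<leftarrow>zs. q * \<Theta>' N)"
    for N and zs :: "(real \<times> ('a, 'b) net \<times> ('a, 'b) dist) list"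
    by (induction zs) (auto simp: algebra_simps)
  have "(\<lambda>A. p * X A + R A) = (\<lambda>N. \<Sum>(q, M, \<Theta>')\<leftarrow>ys. if M = N then q else 0)"
    unfolding ys_def xs(3) map_append sum_list_append 1 by (simp add: o_def R)
  moreover have "(\<lambda>A. p * Y A + R A) = (\<lambda>N. \<Sum>(q, M, \<Theta>')\<leftarrow>ys. q * \<Theta>' N)"
    unfolding ys_def xs(4) map_append sum_list_append 2 by (simp add: o_def R)
  moreover have "\<forall>(q, M, \<Theta>')\<in>set ys. 0 < q \<and> hat_trans M LTau \<Theta>'"
  proof -
    have "0 < R B" if "B \<in> supp R" for B using that assms(4)[of B] by (simp add: supp_def)
    then show ?thesis unfolding ys_def using xs(1) assms(2) bs(1)
      by (auto simp: hat_trans_def)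
  qed
  moreover have "\<exists>z. z \<in> set ys" using xs(2) unfolding ys_def by (cases xs) auto
  ultimately show ?thesis unfolding lift_trans_def by (intro exI[of _ ys]) (simp; fast)
qed

lemma wtau_frame:
  assumes "wtau X Y" "0 < p" "finite (supp R)" "\<And>B. 0 \<le> R B"
  shows "wtau (\<lambda>A. p * X A + R A) (\<lambda>A. p * Y A + R A)"
  using assms(1) unfolding wtau_def
proof (induction rule: rtranclp_induct)
  case (step Y Z)
  then show ?case using lift_trans_frame[OF step(2) assms(2-4)] by (meson rtranclp.rtrancl_into_rtrancl)
qed simp

text \<open>The components may take different numbers of steps. They are moved one after the other,
  with the rest of the weighting held fixed by \<open>wtau_frame\<close>.\<close>

lemma wtau_mix:
  assumes "prob_dist \<Delta>" "\<And>B. B \<in> supp \<Delta> \<Longrightarrow> wtau (dirac B) (F B) \<and> prob_dist (F B)"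
  shows "wtau \<Delta> (mix \<Delta> F)"
proof -
  have fin: "finite (supp \<Delta>)" and nonneg: "\<And>B. 0 \<le> \<Delta> B" using assms(1) by (auto simp: prob_dist_def)
  \<comment> \<open>In \<open>st S\<close> the components in \<open>S\<close> have already moved and
    the others are still in place.\<close>
  define st where
    "st S = (\<lambda>A. (\<Sum>B\<in>S. \<Delta> B * F B A) + (\<Sum>B\<in>supp \<Delta> - S. \<Delta> B * dirac B A))" for S
  have "wtau (st {}) (st S)" if "S \<subseteq> supp \<Delta>" for S
    using finite_subset[OF that fin] that
  proof (induction rule: finite_induct)
    case empty
    then show ?case by (simp add: wtau_def)
  next
    case (insert b S)
    define R where "R A = (\<Sum>B\<in>S. \<Delta> B * F B A) + (\<Sum>B\<in>supp \<Delta> - insert b S. \<Delta> B * dirac B A)" for A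
    have "supp R \<subseteq> (\<Union>B\<in>S. supp (F B)) \<union> supp \<Delta>"
    proof
      fix A assume "A \<in> supp R"
      then have "(\<Sum>B\<in>S. \<Delta> B * F B A) \<noteq> 0 \<or> (\<Sum>B\<in>supp \<Delta> - insert b S. \<Delta> B * dirac B A) \<noteq> 0"
        by (auto simp: supp_def R_def)
      then show "A \<in> (\<Union>B\<in>S. supp (F B)) \<union> supp \<Delta>"
      proof
        assume "(\<Sum>B\<in>S. \<Delta> B * F B A) \<noteq> 0"
        then obtain B where "B \<in> S" "\<Delta> B * F B A \<noteq> 0" by (rule sum.not_neutral_contains_not_neutral)
        then show ?thesis by (auto simp: supp_def)
      next
        assume "(\<Sum>B\<in>supp \<Delta> - insert b S. \<Delta> B * dirac B A) \<noteq> 0"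
        then obtain B where "B \<in> supp \<Delta> - insert b S" "\<Delta> B * dirac B A \<noteq> 0"
          by (rule sum.not_neutral_contains_not_neutral)
        then show ?thesis by (auto simp: dirac_def split: if_splits)
      qed
    qed
    moreover have "finite ((\<Union>B\<in>S. supp (F B)) \<union> supp \<Delta>)"
      using insert.hyps insert.prems fin assms(2) by (auto simp: prob_dist_def)
    ultimately have finR: "finite (supp R)" by (rule finite_subset)
    have nnF: "0 \<le> F B A" if "B \<in> S" for A B
      using that insert.prems assms(2)[of B] by (auto simp: prob_dist_def)
    have nnR: "0 \<le> R A" for A
      unfolding R_def using nonneg nnF by (intro add_nonneg_nonneg sum_nonneg mult_nonneg_nonneg) (auto simp: dirac_def)
    have pos: "0 < \<Delta> b" using insert.prems nonneg[of b] by (auto simp: supp_def)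
    have "(\<Sum>B\<in>supp \<Delta> - S. \<Delta> B * dirac B A)
        = \<Delta> b * dirac b A + (\<Sum>B\<in>supp \<Delta> - insert b S. \<Delta> B * dirac B A)" for A
    proof -
      have eq: "supp \<Delta> - S = insert b (supp \<Delta> - insert b S)" using insert by auto
      show ?thesis unfolding eq by (subst sum.insert) (use fin in auto)
    qed
    then have "st S = (\<lambda>A. \<Delta> b * dirac b A + R A)" by (auto simp: st_def R_def)
    moreover have "st (insert b S) = (\<lambda>A. \<Delta> b * F b A + R A)"
      using insert by (auto simp: st_def R_def)
    ultimately have "wtau (st S) (st (insert b S))"
      using wtau_frame[OF _ pos finR nnR, of "dirac b" "F b"] assms(2)[of b] insert.prems by simp
    then show ?case using insert unfolding wtau_def by (meson insert_subset rtranclp_trans)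
  qed
  from this[OF order_refl] have "wtau (st {}) (st (supp \<Delta>))" .
  moreover have "st (supp \<Delta>) = mix \<Delta> F" by (simp add: st_def mix_def)
  moreover have "st {} = \<Delta>"
  proof
    fix A
    have "(\<Sum>B\<in>supp \<Delta>. \<Delta> B * dirac B A) = (\<Sum>B\<in>supp \<Delta>. if B = A then \<Delta> B else 0)"
      by (rule sum.cong) (auto simp: dirac_def)
    also have "\<dots> = \<Delta> A" using fin by (simp add: supp_def)
    finally show "st {} A = \<Delta> A" by (simp add: st_def)
  qed
  ultimately show ?thesis by simp
qed

section \<open>Silently reaching a network with a given probability\<close>

text \<open>A derivation bounds the probability from below: a branch may be abandoned at bound 0,
  and every bound may be weakened. \<open>c\<close> assigns bounds to networks rather than to
  branches of a choice.\<close>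

inductive reaches :: "('n, 'v) net \<Rightarrow> ('n, 'v) net \<Rightarrow> real \<Rightarrow> bool" for L where
  reaches_zero: "x \<le> 0 \<Longrightarrow> reaches L A x"
| reaches_done: "scong A L \<Longrightarrow> x \<le> 1 \<Longrightarrow> reaches L A x"
| reaches_step: "silent A \<Delta> \<Longrightarrow> (\<And>B. B \<in> supp \<Delta> \<Longrightarrow> reaches L B (c B)) \<Longrightarrow> x \<le> expect \<Delta> c
    \<Longrightarrow> reaches L A x"

lemma silent_valid: "silent A \<Delta> \<Longrightarrow> valid_net A \<Longrightarrow> valid_dist \<Delta>"
  using silent_trans trans_valid by blast

lemma scong_equiv_supp:
  assumes "prob_dist \<Delta>" "prob_dist \<Theta>" "scong_equiv \<Delta> \<Theta>" "B \<in> supp \<Theta>"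
  shows "\<exists>A\<in>supp \<Delta>. scong A B"
proof (rule ccontr)
  assume no: "\<not> ?thesis"
  define f where "f A = (if scong A B then 1 else 0 :: real)" for A
  have "scong_invariant f" unfolding scong_invariant_def f_def using sc_trans sc_sym by metis
  then have "expect \<Delta> f = expect \<Theta> f" using assms(3) by (simp add: scong_equiv_def)
  moreover have "expect \<Delta> f = 0"
    unfolding expect_def using no by (intro sum.neutral) (auto simp: f_def)
  moreover have "\<Theta> B * f B \<le> expect \<Theta> f"
    unfolding expect_def using assms(2,4)
    by (intro member_le_sum) (auto simp: prob_dist_def f_def)
  moreover have "0 < \<Theta> B"
    using assms(2,4) by (metis (mono_tags) prob_dist_def less_eq_real_def mem_Collect_eq supp_def)
  ultimately show False by (simp add: f_def sc_refl)
qed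

lemma reaches_scong:
  assumes "reaches L A x" "scong A B" "valid_net A" "valid_net B"
  shows "reaches L B x"
  using assms
proof (induction arbitrary: B)
  case (reaches_zero x A)
  then show ?case by (simp add: reaches.reaches_zero)
next
  case (reaches_done A x)
  then show ?case using sc_trans sc_sym reaches.reaches_done by meson
next
  case (reaches_step A \<Delta> c x)
  obtain \<Theta> where \<Theta>: "silent B \<Theta>" "scong_equiv \<Delta> \<Theta>"
    using silent_scong[OF reaches_step.prems(1) reaches_step.hyps(1)] by blast
  have v: "valid_dist \<Delta>" "valid_dist \<Theta>"
    using silent_valid reaches_step.hyps(1) reaches_step.prems(2,3) \<Theta>(1) by blast+
  then have pd: "prob_dist \<Delta>" "prob_dist \<Theta>" by (auto simp: valid_dist_def)
  then have fin: "finite (supp \<Delta>)" by (simp add: prob_dist_def)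
  \<comment> \<open>The bounds \<open>c\<close> need not be constant on classes, while
    \<open>scong_equiv\<close> compares only class functions; \<open>c'\<close> therefore takes the
    largest bound on a class. It is attained at a congruent network in the support of \<Delta>, from
    which the induction hypothesis transfers it.\<close>
  define cl where "cl B' = {A'\<in>supp \<Delta>. scong A' B'}" for B'
  define c' where "c' B' = Max (c ` cl B')" for B'
  have cl: "finite (cl B')" for B' unfolding cl_def using fin by simp
  have "cl A' = cl B'" if "scong A' B'" for A' B'
    unfolding cl_def using that sc_trans sc_sym by blast
  then have inv: "scong_invariant c'" unfolding scong_invariant_def c'_def by simp
  have "c A' \<le> c' A'" if "A' \<in> supp \<Delta>" for A'
    unfolding c'_def using that cl by (intro Max_ge) (auto simp: cl_def sc_refl)
  then have "expect \<Delta> c \<le> expect \<Delta> c'"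
    using pd(1) by (intro expect_mono) (auto simp: prob_dist_def)
  then have "x \<le> expect \<Theta> c'"
    using \<Theta>(2) inv reaches_step.hyps(3) by (simp add: scong_equiv_def)
  moreover have "reaches L B' (c' B')" if B': "B' \<in> supp \<Theta>" for B'
  proof -
    have "cl B' \<noteq> {}" using scong_equiv_supp[OF pd \<Theta>(2) B'] by (auto simp: cl_def)
    then have "c' B' \<in> c ` cl B'" unfolding c'_def using cl by (intro Max_in) auto
    then obtain A' where A': "A' \<in> supp \<Delta>" "scong A' B'" "c' B' = c A'" by (auto simp: cl_def)
    have "valid_net A'" "valid_net B'" using v A'(1) B' by (auto simp: valid_dist_def)
    then show ?thesis using reaches_step.IH[OF A'(1,2)] A'(3) by simp
  qed
  ultimately show ?case using \<Theta>(1) reaches.reaches_step by meson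
qed

lemma reaches_wtau:
  assumes "reaches L A x" "valid_net A"
  shows "\<exists>\<Theta>. wtau (dirac A) \<Theta> \<and> valid_dist \<Theta> \<and> x \<le> expect \<Theta> (\<lambda>B. if scong B L then 1 else 0)"
  using assms
proof induction
  case (reaches_zero x A)
  then show ?case by (intro exI[of _ "dirac A"]) (simp add: wtau_def)
next
  case (reaches_done A x)
  then show ?case by (intro exI[of _ "dirac A"]) (simp add: wtau_def)
next
  case (reaches_step A \<Delta> c x)
  let ?f = "\<lambda>B. if scong B L then 1 else 0 :: real"
  have v: "valid_dist \<Delta>" using silent_valid reaches_step.hyps(1) reaches_step.prems by blast
  then have pd: "prob_dist \<Delta>" by (simp add: valid_dist_def)
  have "\<exists>\<Theta>. wtau (dirac B) \<Theta> \<and> valid_dist \<Theta> \<and> c B \<le> expect \<Theta> ?f" if "B \<in> supp \<Delta>" for B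
    using reaches_step.IH[OF that] v that by (simp add: valid_dist_def)
  then obtain F where F: "\<And>B. B \<in> supp \<Delta> \<Longrightarrow> wtau (dirac B) (F B)"
    "\<And>B. B \<in> supp \<Delta> \<Longrightarrow> valid_dist (F B)" "\<And>B. B \<in> supp \<Delta> \<Longrightarrow> c B \<le> expect (F B) ?f"
    by metis
  have Fpd: "prob_dist (F B)" if "B \<in> supp \<Delta>" for B using F(2)[OF that] by (simp add: valid_dist_def)
  have "wtau (dirac A) \<Delta>" using wtau_trans silent_trans reaches_step.hyps(1) by blast
  moreover have "wtau \<Delta> (mix \<Delta> F)" using wtau_mix[OF pd] F(1) Fpd by blast
  ultimately have "wtau (dirac A) (mix \<Delta> F)" unfolding wtau_def by (rule rtranclp_trans)
  moreover have "valid_dist (mix \<Delta> F)"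
    using prob_dist_mix[OF pd, of F] Fpd F(2) supp_mix[of \<Delta> F] unfolding valid_dist_def by blast
  moreover have "x \<le> expect (mix \<Delta> F) ?f"
  proof -
    have "expect \<Delta> c \<le> expect \<Delta> (\<lambda>B. expect (F B) ?f)"
      using pd F(3) by (intro expect_mono) (auto simp: prob_dist_def)
    also have "\<dots> = expect (mix \<Delta> F) ?f"
      by (rule expect_mix[symmetric]) (use pd Fpd in \<open>auto simp: prob_dist_def\<close>)
    finally show ?thesis using reaches_step.hyps(3) by linarith
  qed
  ultimately show ?case by blast
qed

text \<open>The missing weight of the mixture is exactly the weight of the components without a
  response, so completing it afterwards amounts to sending each such component to
  \<open>Bot\<close>.\<close>

lemma bot_complete_mix:
  assumes "prob_dist \<Theta>" "\<And>B. B \<in> supp \<Theta> \<Longrightarrow> b B \<Longrightarrow> prob_dist (F B)"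
    "\<And>B. B \<in> supp \<Theta> \<Longrightarrow> \<not> b B \<Longrightarrow> F B = (\<lambda>_. 0)"
  shows "bot_complete (mix \<Theta> F) = mix \<Theta> (\<lambda>B. if b B then F B else dirac Bot)"
proof -
  have fin: "finite (supp \<Theta>)" using assms(1) by (simp add: prob_dist_def)
  have finF: "finite (supp (F B))" if "B \<in> supp \<Theta>" for B
    using assms(2,3)[OF that] by (cases "b B") (auto simp: prob_dist_def supp_def)
  have one: "expect (F B) (\<lambda>_. 1) = (if b B then 1 else 0)" if "B \<in> supp \<Theta>" for B
    using assms(2,3)[OF that] by (auto simp: prob_dist_def) (simp add: expect_def)
  have "mass (mix \<Theta> F) = expect \<Theta> (\<lambda>B. expect (F B) (\<lambda>_. 1))"
    unfolding mass_eq_expect by (rule expect_mix[OF fin finF])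
  also have "\<dots> = expect \<Theta> (\<lambda>B. if b B then 1 else 0)"
    by (rule expect_cong) (rule one)
  finally have mass: "mass (mix \<Theta> F) = expect \<Theta> (\<lambda>B. if b B then 1 else 0)" .
  have "1 - mass (mix \<Theta> F) = expect \<Theta> (\<lambda>_. 1) - mass (mix \<Theta> F)"
    using assms(1) by (simp add: prob_dist_def)
  also have "\<dots> = expect \<Theta> (\<lambda>B. if b B then 0 else 1)"
    unfolding mass unfolding expect_def by (subst sum_subtractf[symmetric]) (rule sum.cong; simp)
  finally have rest: "1 - mass (mix \<Theta> F) = expect \<Theta> (\<lambda>B. if b B then 0 else 1)" .
  show ?thesis
  proof
    fix A
    have "bot_complete (mix \<Theta> F) A
        = (\<Sum>B\<in>supp \<Theta>. \<Theta> B * F B A) + (\<Sum>B\<in>supp \<Theta>. \<Theta> B * (if b B then 0 else 1) * dirac Bot A)"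
      unfolding bot_complete_def rest by (simp only: mix_def expect_def sum_distrib_right)
    also have "\<dots> = (\<Sum>B\<in>supp \<Theta>. \<Theta> B * (if b B then F B else dirac Bot) A)"
      unfolding sum.distrib[symmetric] by (rule sum.cong) (auto simp: assms(3))
    finally show "bot_complete (mix \<Theta> F) A = mix \<Theta> (\<lambda>B. if b B then F B else dirac Bot) A"
      by (simp add: mix_def)
  qed
qed

lemma hat_transI: "trans B l \<Delta> \<Longrightarrow> hat_trans B l \<Delta>"
  by (cases "l = LTau") (auto simp: hat_trans_def)

lemma hat_trans_valid: "hat_trans B l \<Delta> \<Longrightarrow> valid_net B \<Longrightarrow> valid_dist \<Delta>"
  using trans_valid[of B l \<Delta>] trans_valid[of B LTau \<Delta>]
  by (auto simp: hat_trans_def split: if_splits)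

text \<open>Components congruent to \<open>L\<close> answer with an equivalent distribution at cost
  0; all others are charged at most 1. Positivity of \<open>y\<close> provides at least one
  component that can move, as a lifted transition requires.\<close>

lemma simulate_reached:
  fixes A B :: "('n, 'v) net"
  assumes A: "scong A L" "trans A l \<Delta>" "topology_ok A" "valid_net A" "alpha_lab l"
    and B: "valid_net B" "reaches L B y" "0 < y"
    and d: "\<And>M N. d M N \<le> 1" "\<And>M N. scong M N \<Longrightarrow> d M N = 0"
  shows "\<exists>\<Theta>. weak (dirac B) l \<Theta> \<and> coupled d \<Delta> (bot_complete \<Theta>) (1 - y)"
proof -
  define g where "g = (\<lambda>B. if scong B L then 1 else 0 :: real)"
  obtain \<Psi> where \<Psi>: "wtau (dirac B) \<Psi>" "valid_dist \<Psi>" "y \<le> expect \<Psi> g"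
    using reaches_wtau[OF B(2,1)] unfolding g_def by blast
  have pd: "prob_dist \<Psi>" using \<Psi>(2) by (simp add: valid_dist_def)
  \<comment> \<open>A single response function serves two purposes: a matching answer at networks
    congruent to \<open>L\<close>, and some available transition elsewhere, since a component that
    can move may not be dropped.\<close>
  have "\<exists>\<Theta>. (scong C L \<longrightarrow> hat_trans C l \<Theta> \<and> scong_equiv \<Delta> \<Theta>)
      \<and> (has_hat C l \<longrightarrow> hat_trans C l \<Theta>) \<and> (\<not> has_hat C l \<longrightarrow> \<Theta> = (\<lambda>_. 0))" for C
  proof (cases "scong C L")
    case True
    then have "scong A C" using A(1) sc_trans sc_sym by blast
    then obtain \<Theta> where \<Theta>: "trans C l \<Theta>" "scong_equiv \<Delta> \<Theta>" using trans_scong A(2,3,5) by blast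
    then have "hat_trans C l \<Theta>" by (intro hat_transI)
    then show ?thesis using \<Theta>(2) unfolding has_hat_def by blast
  next
    case False
    then show ?thesis unfolding has_hat_def by blast
  qed
  then obtain F where F: "\<And>C. scong C L \<Longrightarrow> hat_trans C l (F C) \<and> scong_equiv \<Delta> (F C)"
    "\<And>C. has_hat C l \<Longrightarrow> hat_trans C l (F C)" "\<And>C. \<not> has_hat C l \<Longrightarrow> F C = (\<lambda>_. 0)"
    by metis
  have Fpd: "prob_dist (F C)" if "C \<in> supp \<Psi>" "has_hat C l" for C
    using hat_trans_valid[OF F(2)[OF that(2)]] \<Psi>(2) that(1) by (auto simp: valid_dist_def)
  have "\<exists>C\<in>supp \<Psi>. scong C L"
  proof (rule ccontr)
    assume "\<not> ?thesis"
    then have "expect \<Psi> g = 0" unfolding expect_def g_def by (intro sum.neutral) auto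
    then show False using \<Psi>(3) B(3) by simp
  qed
  then have "\<exists>C\<in>supp \<Psi>. has_hat C l" using F(1) unfolding has_hat_def by blast
  then have "lift_trans \<Psi> l (mix \<Psi> F)"
    using pd F(2,3) by (intro lift_transI) (auto simp: prob_dist_def)
  then have "weak (dirac B) l (mix \<Psi> F)"
    using \<Psi>(1) unfolding weak_def wtau_def
    by (auto intro: rtranclp.rtrancl_into_rtrancl)
  moreover have "coupled d \<Delta> (bot_complete (mix \<Psi> F)) (expect \<Psi> (\<lambda>C. 1 - g C))"
  proof -
    have \<Delta>: "prob_dist \<Delta>" using trans_valid[OF A(2,4)] by (simp add: valid_dist_def)
    have "coupled d \<Delta> (mix \<Psi> (\<lambda>C. if has_hat C l then F C else dirac Bot)) (expect \<Psi> (\<lambda>C. 1 - g C))"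
    proof (rule coupled_mix[OF pd])
      fix C assume C: "C \<in> supp \<Psi>"
      show "coupled d \<Delta> (if has_hat C l then F C else dirac Bot) (1 - g C)"
      proof (cases "scong C L")
        case True
        then have h: "has_hat C l" using F(1) unfolding has_hat_def by blast
        have "coupled d \<Delta> (F C) 0"
          using coupled_scong_equiv[OF \<Delta> Fpd[OF C h]] F(1)[OF True] d(2) by blast
        then show ?thesis using h True by (simp add: g_def)
      next
        case False
        have "prob_dist (if has_hat C l then F C else dirac Bot)" using Fpd[OF C] by simp
        then show ?thesis using coupled_one[OF \<Delta> _ d(1)] False by (simp add: g_def)
      qed
    qed
    then show ?thesis
      using bot_complete_mix[OF pd, where b="\<lambda>C. has_hat C l" and F=F] Fpd F(3) by simp
  qed
  moreover have "expect \<Psi> (\<lambda>C. 1 - g C) \<le> 1 - y"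
  proof -
    have "expect \<Psi> (\<lambda>C. 1 - g C) = expect \<Psi> (\<lambda>_. 1) - expect \<Psi> g"
      by (simp add: expect_def algebra_simps sum_subtractf)
    then show ?thesis using pd \<Psi>(3) by (simp add: prob_dist_def)
  qed
  ultimately show ?thesis unfolding coupled_def using order_trans by blast
qed

lemma weak_trans: "trans B l \<Theta> \<Longrightarrow> weak (dirac B) l \<Theta>"
proof -
  assume "trans B l \<Theta>"
  then have h: "hat_trans B l \<Theta>" "has_hat B l" unfolding has_hat_def using hat_transI by blast+
  then have "lift_trans (dirac B) l (mix (dirac B) (\<lambda>_. \<Theta>))"
    by (intro lift_transI) (auto simp: dirac_nonneg)
  then show ?thesis unfolding weak_def wtau_def by (auto simp: mix_dirac_left)
qed

lemma scong_cong:
  assumes "scong A B"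
  shows "scong A C \<longleftrightarrow> scong B C" "scong C A \<longleftrightarrow> scong C B"
  using assms sc_trans[of A B C] sc_trans[of B A C] sc_trans[of C A B] sc_trans[of C B A] sc_sym[OF assms]
  by blast+

text \<open>Reachability is demanded only when \<open>A\<close> has a move, which is when the
  simulation condition asks for a response.\<close>

lemma mdist_le_reaches:
  fixes L M :: "('n, 'v) net"
  assumes r: "0 \<le> r" "r \<le> 1"
    and reach: "\<And>A B l \<Delta>. scong A L \<Longrightarrow> scong B M \<Longrightarrow> wf_net B \<Longrightarrow> trans A l \<Delta> \<Longrightarrow> topology_ok A
      \<Longrightarrow> alpha_lab l \<Longrightarrow> reaches L B (1 - r)"
  shows "mdist L M \<le> r"
proof -
  define d :: "('n, 'v) net \<Rightarrow> ('n, 'v) net \<Rightarrow> real" where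
    "d A B = (if scong A B then 0 else if scong A L \<and> scong B M then r else 1)" for A B
  have d01: "0 \<le> d A B" "d A B \<le> 1" for A B using r by (auto simp: d_def)
  have d0: "d A B = 0" if "scong A B" for A B using that by (simp add: d_def)
  have "d A C \<le> d A B + d B C" for A B C
  proof (cases "scong A B")
    case True
    have "d A C = d B C" unfolding d_def scong_cong[OF True] ..
    then show ?thesis using d01 by simp
  next
    case AB: False
    show ?thesis
    proof (cases "scong B C")
      case True
      have "d A C = d A B" unfolding d_def scong_cong[OF True] ..
      then show ?thesis using d01 by simp
    next
      case BC: False
      show ?thesis
      \<comment> \<open>Chaining two steps from the class of \<open>L\<close> to the class of
        \<open>M\<close> identifies the two classes through \<open>B\<close>, so the end points are
        congruent.\<close>
      proof (cases "scong A L \<and> scong B M \<and> scong B L \<and> scong C M")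
        case True
        then have "scong A C" using scong_cong by blast
        then show ?thesis using d0 d01[of A B] d01[of B C] by simp
      next
        case False
        then have "d A B = 1 \<or> d B C = 1" using AB BC by (auto simp: d_def)
        then show ?thesis using d01[of A B] d01[of B C] d01[of A C] by linarith
      qed
    qed
  qed
  then have pq: "pseudoquasimetric d" unfolding pseudoquasimetric_def using d01 d0 sc_refl by blast
  have "\<exists>\<Theta>. weak (dirac B) l \<Theta> \<and> kant d \<Delta> (bot_complete \<Theta>) \<le> d A B"
    if wf: "wf_net A" "wf_net B" and lt: "d A B < 1" and l: "alpha_lab l" "trans A l \<Delta>" for A B l \<Delta>
  proof -
    have v: "valid_net A" "valid_net B" "topology_ok A"
      using wf by (auto intro: valid_net_wf wf_net_topology_ok)
    have \<Delta>: "prob_dist \<Delta>" using trans_valid[OF l(2) v(1)] by (simp add: valid_dist_def)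
    show ?thesis
    proof (cases "scong A B")
      case True
      obtain \<Theta> where \<Theta>: "trans B l \<Theta>" "scong_equiv \<Delta> \<Theta>"
        using trans_scong[OF True l(2) v(3) l(1)] by blast
      have pd: "prob_dist \<Theta>" using trans_valid[OF \<Theta>(1) v(2)] by (simp add: valid_dist_def)
      have "coupled d \<Delta> (bot_complete \<Theta>) 0"
        using coupled_scong_equiv[OF \<Delta> pd \<Theta>(2) d0] pd by simp
      then have "kant d \<Delta> (bot_complete \<Theta>) \<le> 0" using kant_le d01(1) by blast
      then show ?thesis using weak_trans[OF \<Theta>(1)] d0[OF True] by auto
    next
      case False
      \<comment> \<open>A distance below 1 leaves only this pair of classes and forces
        \<open>r < 1\<close>, so that the bound \<open>1 - r\<close> is positive.\<close>
      then have AB: "scong A L" "scong B M" "d A B = r" "r < 1"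
        using lt by (auto simp: d_def split: if_splits)
      have "reaches L B (1 - r)" using reach AB(1,2) wf(2) l v(3) by blast
      then obtain \<Theta> where \<Theta>: "weak (dirac B) l \<Theta>" "coupled d \<Delta> (bot_complete \<Theta>) (1 - (1 - r))"
        using simulate_reached[OF AB(1) l(2) v(3,1) l(1) v(2) _ _ d01(2) d0] AB(4) by force
      have "kant d \<Delta> (bot_complete \<Theta>) \<le> 1 - (1 - r)" using kant_le[OF \<Theta>(2) d01(1)] .
      then show ?thesis using \<Theta>(1) AB(3) by auto
    qed
  qed
  then have "weak_sim_qm d" unfolding weak_sim_qm_def using pq by blast
  then have "d L M \<in> {d' L M |d'. weak_sim_qm d'}" by blast
  moreover have "bdd_below {d' L M |d'. weak_sim_qm d'}"
    by (rule bdd_belowI[of _ 0]) (auto simp: weak_sim_qm_def pseudoquasimetric_def)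
  ultimately have "mdist L M \<le> d L M" unfolding mdist_def by (rule cInf_lower)
  also have "d L M \<le> r" using r by (auto simp: d_def sc_refl)
  finally show ?thesis .
qed

section \<open>One round of the gossip protocol\<close>

definition exactly_one :: "('a \<Rightarrow> real) \<Rightarrow> 'a set \<Rightarrow> real" where
  "exactly_one p K = (\<Sum>i\<in>K. p i * (\<Prod>j\<in>K - {i}. 1 - p j))"

text \<open>Conditioning on the coin of \<open>k\<close>: either it succeeds and all others fail, or
  it fails and exactly one of the others succeeds.\<close>

lemma exactly_one_insert:
  assumes "finite K" "k \<notin> K"
  shows "exactly_one p (insert k K) = p k * (\<Prod>j\<in>K. 1 - p j) + (1 - p k) * exactly_one p K"
proof -
  have "p i * (\<Prod>j\<in>insert k K - {i}. 1 - p j) = (1 - p k) * (p i * (\<Prod>j\<in>K - {i}. 1 - p j))"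
    if "i \<in> K" for i
  proof -
    have "insert k K - {i} = insert k (K - {i})" using that assms(2) by auto
    then show ?thesis using assms by simp
  qed
  then have "(\<Sum>i\<in>K. p i * (\<Prod>j\<in>insert k K - {i}. 1 - p j)) = (1 - p k) * exactly_one p K"
    unfolding exactly_one_def sum_distrib_left by (rule sum.cong[OF refl])
  moreover have "insert k K - {k} = K" using assms(2) by auto
  ultimately show ?thesis using assms by (simp add: exactly_one_def)
qed

lemma exactly_one_bounds:
  assumes "finite K" "\<forall>i\<in>K. 0 \<le> p i \<and> p i \<le> 1"
  shows "0 \<le> exactly_one p K" "exactly_one p K \<le> 1"
proof -
  show "0 \<le> exactly_one p K"
    unfolding exactly_one_def using assms(2) by (intro sum_nonneg mult_nonneg_nonneg prod_nonneg) auto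
  \<comment> \<open>Exactly one success and no success are disjoint events; the sum of their
    probabilities is the quantity that goes through the induction.\<close>
  have "exactly_one p K + (\<Prod>j\<in>K. 1 - p j) \<le> 1"
    using assms
  proof (induction K)
    case empty
    then show ?case by (simp add: exactly_one_def)
  next
    case (insert k K)
    let ?P = "\<Prod>j\<in>K. 1 - p j"
    have "exactly_one p (insert k K) + (\<Prod>j\<in>insert k K. 1 - p j)
        = p k * ?P + (1 - p k) * (exactly_one p K + ?P)"
      using insert by (simp add: exactly_one_insert algebra_simps)
    also have "\<dots> \<le> p k * 1 + (1 - p k) * 1"
      using insert by (intro add_mono mult_left_mono prod_le_1) auto
    finally show ?case by simp
  qed
  moreover have "0 \<le> (\<Prod>j\<in>K. 1 - p j)" using assms(2) by (intro prod_nonneg) auto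
  ultimately show "exactly_one p K \<le> 1" by linarith
qed

text \<open>The processes are given by a function of the index, so that resolving a coin is a
  function update and leaves the tree of parallel compositions unchanged.\<close>

primrec node_list :: "(nat \<Rightarrow> 'n) \<Rightarrow> (nat \<Rightarrow> 'n set) \<Rightarrow> (nat \<Rightarrow> 'v proc) \<Rightarrow> nat list \<Rightarrow> ('n, 'v) net" where
  "node_list m \<nu> f [] = Zero"
| "node_list m \<nu> f (i # is) = Par (Node (m i) (f i) (\<nu> i)) (node_list m \<nu> f is)"

lemma nprod_node_list:
  "nprod I (\<lambda>i. Node (m i) (f i) (\<nu> i)) = node_list m \<nu> f (sorted_list_of_set I)"
proof -
  have "foldr (\<lambda>i M. Par (Node (m i) (f i) (\<nu> i)) M) is Zero = node_list m \<nu> f is" for "is"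
    by (induction "is") auto
  then show ?thesis by (simp add: nprod_def)
qed

lemma bot_free_node_list [simp]: "bot_free (node_list m \<nu> f is)"
  by (induction "is") auto

lemma sites_node_list [simp]: "sites (node_list m \<nu> f is) = map (\<lambda>i. (m i, \<nu> i)) is"
  by (induction "is") auto

lemma nds_node_list [simp]: "nds (node_list m \<nu> f is) = m ` set is"
  by (induction "is") auto

lemma nodes_node_list [simp]: "nodes (node_list m \<nu> f is) = map (\<lambda>i. (m i, f i, \<nu> i)) is"
  by (induction "is") auto

lemma node_list_cong: "(\<And>i. i \<in> set is \<Longrightarrow> f i = g i) \<Longrightarrow> node_list m \<nu> f is = node_list m \<nu> g is"
  by (induction "is") auto

lemma node_list_inject:
  "node_list m \<nu> f is = node_list m \<nu> g is \<Longrightarrow> i \<in> set is \<Longrightarrow> f i = g i"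
  by (induction "is") auto

lemma core_tau_node_list:
  assumes "distinct is" "k \<in> set is" "f k = TauP C"
  shows "core (node_list m \<nu> f is) LTau
    (list_dist (map (\<lambda>(w, P). (w, node_list m \<nu> (f(k := P)) is)) C))"
  using assms
proof (induction "is")
  case (Cons i "is")
  show ?case
  proof (cases "i = k")
    case True
    have rest: "node_list m \<nu> (f(k := P)) is = node_list m \<nu> f is" for P
      using Cons.prems True by (intro node_list_cong) auto
    have "core (node_list m \<nu> f (i # is)) LTau (pard (den (m k) C (\<nu> k)) (dirac (node_list m \<nu> f is)))"
      using True Cons.prems by (auto intro: core_TauParL core_Tau)
    then show ?thesis
      unfolding den_eq_list_dist pard_list_dist_dirac by (simp add: True rest[unfolded fun_upd_def] fun_upd_def o_def split_def)
  next
    case False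
    have "core (node_list m \<nu> f (i # is)) LTau (pard (dirac (Node (m i) (f i) (\<nu> i)))
        (list_dist (map (\<lambda>(w, P). (w, node_list m \<nu> (f(k := P)) is)) C)))"
      unfolding node_list.simps
      by (rule core_TauParR[OF Cons.IH]) (use False Cons.prems in auto)
    then show ?thesis
      unfolding pard_dirac_list_dist using False by (simp add: fun_upd_def o_def split_def)
  qed
qed simp

text \<open>In the one-node network over the unit type a node receives from itself only if it listens.\<close>
lemma not_rcv_PNil: "\<not> rcv (PNil :: 'v proc)"
proof
  assume "rcv (PNil :: 'v proc)"
  then obtain x C and D :: "'v chc" where "scong (Node () PNil UNIV) (Node () (In x C D) UNIV)"
    unfolding rcv_def by blast
  then have "core_sim (Node () (In x C D) UNIV) (Node () PNil UNIV)" using scong_core_sim by blast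
  moreover have "core (Node () (In x C D) UNIV) (LRcv () v) (den () (cvsub x v C) UNIV)" for v
    by (rule core_Rcv) simp
  ultimately have "\<exists>\<Theta>. core (Node () (PNil :: 'v proc) UNIV) (LRcv () undefined) \<Theta>"
    using core_simD by blast
  then show False by (auto elim: core.cases)
qed

lemma den_single [simp]: "den n [(1, P)] \<nu> = dirac (Node n P \<nu>)"
  by (auto simp: den_def dirac_def)

text \<open>All nodes but the sender are \<open>nil\<close> and cannot receive, so each of them
  stays as it is and only leaves the audience.\<close>

lemma core_snd_node_list:
  assumes "distinct is" "k \<in> set is" "f k = Out (Val v) [(1, PNil)]"
    "\<And>i. i \<in> set is \<Longrightarrow> i \<noteq> k \<Longrightarrow> f i = PNil \<and> m i \<noteq> m k"
  shows "core (node_list m \<nu> f is) (LSnd (m k) v (\<nu> k - m ` (set is - {k})))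
    (dirac (node_list m \<nu> (\<lambda>_. PNil) is))"
  using assms
proof (induction "is")
  case (Cons i "is")
  show ?case
  proof (cases "i = k")
    case True
    have "PNil = f j" if "j \<in> set is" for j
    proof -
      have "j \<noteq> k" using Cons.prems(1) that True by auto
      then show ?thesis using Cons.prems(4)[of j] that by simp
    qed
    then have nil: "node_list m \<nu> (\<lambda>_. PNil) is = node_list m \<nu> f is"
      by (rule node_list_cong)
    have "core (Node (m k) (f k) (\<nu> k)) (LSnd (m k) v (\<nu> k)) (dirac (Node (m k) PNil (\<nu> k)))"
      using core_Snd[of "m k" v "[(1, PNil)]" "\<nu> k"] Cons.prems(3) by simp
    moreover have "core (node_list m \<nu> f is) (LRcv (m k) v) (dirac (node_list m \<nu> f is))"
    proof (rule core_ignore)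
      show "m k \<notin> nds (node_list m \<nu> f is)" using Cons.prems True by force
      show "\<not> (m k \<in> \<mu> \<and> rcv P)" if "(l, P, \<mu>) \<in> set (nodes (node_list m \<nu> f is))" for l P \<mu>
      proof -
        have "P = PNil" using that Cons.prems True by auto
        then show ?thesis using not_rcv_PNil by blast
      qed
    qed simp
    ultimately have "core (node_list m \<nu> f (i # is)) (LSnd (m k) v (\<nu> k - m ` set is))
        (pard (dirac (Node (m k) PNil (\<nu> k))) (dirac (node_list m \<nu> f is)))"
      unfolding node_list.simps True by (rule core_BcastL) simp
    moreover have "set (i # is) - {k} = set is" using Cons.prems True by auto
    ultimately show ?thesis by (simp add: True nil pard_dirac)
  next
    case False
    have fi: "f i = PNil" "m i \<noteq> m k" using Cons.prems(4)[of i] False by auto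
    have "core (Node (m i) (f i) (\<nu> i)) (LRcv (m k) v) (dirac (Node (m i) PNil (\<nu> i)))"
      unfolding fi(1) by (rule core_RcvEnb) (use fi not_rcv_PNil in auto)
    moreover have "core (node_list m \<nu> f is) (LSnd (m k) v (\<nu> k - m ` (set is - {k})))
        (dirac (node_list m \<nu> (\<lambda>_. PNil) is))"
      using Cons False by auto
    moreover have "\<nu> k - m ` (set (i # is) - {k}) = \<nu> k - m ` (set is - {k}) - nds (Node (m i) (f i) (\<nu> i))"
      using False by auto
    ultimately show ?thesis
      unfolding node_list.simps pard_dirac[symmetric] by (intro core_BcastR)
  qed
qed simp

text \<open>One unfolding of the recursion exposes the receiving prefix. \<open>resndc\<close>
  contains no process variable, and its \<open>Var 0\<close> sits in the timeout branch, outside the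
  scope of the binder, so value substitution reaches it.\<close>

lemma core_rcv_fwdc:
  assumes "k \<in> \<nu>"
  shows "core (Node n (fwdc q) \<nu>) (LRcv k v) (dirac (Node n (resndc (Val v) q) \<nu>))"
proof -
  let ?C = "[(1, psub 0 (fwdc q) (resndc (Var 0) q))]"
  have "psub 0 (fwdc q) (In 0 [(1, resndc (Var 0) q)] [(1, PVar 0)]) = In 0 ?C [(1, fwdc q)]"
    by simp
  then have "core (Node n (psub 0 (fwdc q) (In 0 [(1, resndc (Var 0) q)] [(1, PVar 0)])) \<nu>) (LRcv k v)
      (den n (cvsub 0 v ?C) \<nu>)"
    using core_Rcv[OF assms, of n 0 ?C] by simp
  moreover have "cvsub 0 v ?C = [(1, resndc (Val v) q)]"
    by (simp add: cvsub_def resndc_def sndg_def oplus_def)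
  ultimately show ?thesis using core_Rec unfolding fwdc_def by fastforce
qed

lemma core_rcv_node_list:
  assumes "\<And>j. j \<in> set js \<Longrightarrow> k \<in> \<nu> j"
  shows "core (node_list n \<nu> (\<lambda>j. fwdc (q j)) js) (LRcv k v)
    (dirac (node_list n \<nu> (\<lambda>j. resndc (Val v) (q j)) js))"
  using assms
proof (induction js)
  case Nil
  then show ?case by (simp add: core_RcvZero)
next
  case (Cons j js)
  then show ?case
    unfolding node_list.simps pard_dirac[symmetric] by (intro core_RcvPar core_rcv_fwdc) auto
qed

text \<open>\<open>top\<close> holds for arbitrary \<open>f\<close> and \<open>g\<close>, as it does
  not depend on the processes. By \<open>covers\<close> and symmetry every forwarder hears every
  sender; \<open>enclosed\<close> keeps each audience inside the network, which is what hides the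
  broadcast.\<close>

locale gossip_round =
  fixes N :: "('n, 'v) net" and "is" js :: "nat list" and m n :: "nat \<Rightarrow> 'n"
    and \<nu>m \<nu>n :: "nat \<Rightarrow> 'n set" and p q :: "nat \<Rightarrow> real" and v :: 'v
  assumes distinct: "distinct is"
    and p: "i \<in> set is \<Longrightarrow> 0 \<le> p i \<and> p i \<le> 1"
    and bot_free: "bot_free N"
    and top: "topology_ok (Par (Par N (node_list m \<nu>m f is)) (node_list n \<nu>n g js))"
    and covers: "i \<in> set is \<Longrightarrow> n ` set js \<subseteq> \<nu>m i"
    and enclosed: "i \<in> set is \<Longrightarrow> \<nu>m i \<subseteq> nds N \<union> m ` set is \<union> n ` set js"
    and deaf: "i \<in> set is \<Longrightarrow> (k, P, \<mu>) \<in> set (nodes N) \<Longrightarrow> k \<in> \<nu>m i \<Longrightarrow> \<not> rcv P"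
begin

definition state :: "(nat \<Rightarrow> 'v proc) \<Rightarrow> ('n, 'v) net" where
  "state f = Par (Par N (node_list m \<nu>m f is)) (node_list n \<nu>n (\<lambda>j. fwdc (q j)) js)"

definition goal :: "('n, 'v) net" where
  "goal = Par (Par N (node_list m \<nu>m (\<lambda>_. PNil) is)) (node_list n \<nu>n (\<lambda>j. resndc (Val v) (q j)) js)"

abbreviation "sending \<equiv> Out (Val v) [(1, PNil)]"

lemma silent_state_tau:
  assumes "k \<in> set is" "f k = TauP C"
  shows "silent (state f) (list_dist (map (\<lambda>(w, P). (w, state (f(k := P)))) C))"
proof -
  have "core (state f) LTau (pard (pard (dirac N) (list_dist (map (\<lambda>(w, P). (w, node_list m \<nu>m (f(k := P)) is)) C)))
      (dirac (node_list n \<nu>n (\<lambda>j. fwdc (q j)) js)))"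
    unfolding state_def using core_tau_node_list[where k=k and f=f, OF distinct assms] bot_free
    by (intro core_TauParL core_TauParR) auto
  then show ?thesis
    unfolding silent_def pard_dirac_list_dist pard_list_dist_dirac state_def
    by (simp add: o_def split_def)
qed

lemma silent_state_snd:
  assumes k: "k \<in> set is" "f k = sending" "\<And>i. i \<in> set is \<Longrightarrow> i \<noteq> k \<Longrightarrow> f i = PNil"
  shows "silent (state f) (dirac goal)"
proof -
  let ?top = "Par (Par N (node_list m \<nu>m f is)) (node_list n \<nu>n f js)"
  have dist: "distinct (map fst (sites N) @ map m is @ map n js)"
    using top[of f f] unfolding topology_ok_def by (simp add: o_def)
  have sk: "(m k, \<nu>m k) \<in> set (sites ?top)" using k(1) by simp
  have inj: "m i \<noteq> m k" if "i \<in> set is" "i \<noteq> k" for i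
  proof -
    have "inj_on m (set is)" using dist by (simp add: distinct_map)
    then show ?thesis using that k(1) by (auto dest: inj_onD)
  qed
  have "core (node_list m \<nu>m f is) (LSnd (m k) v (\<nu>m k - m ` (set is - {k})))
    (dirac (node_list m \<nu>m (\<lambda>_. PNil) is))"
    by (rule core_snd_node_list[where k=k and f=f, OF distinct k(1,2)]) (use k(3) inj in auto)
  moreover have "core N (LRcv (m k) v) (dirac N)"
  proof (rule core_ignore[OF bot_free])
    show "m k \<notin> nds N" using dist k(1) by (auto simp: nds_sites)
    show "\<not> (m k \<in> \<mu> \<and> rcv P)" if lP: "(l, P, \<mu>) \<in> set (nodes N)" for l P \<mu>
    proof -
      have "(l, \<mu>) \<in> set (sites N)" using lP by (force simp: sites_def)
      then have "(l, \<mu>) \<in> set (sites ?top)" by simp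
      from topology_ok_sym[OF top[of f f] this sk] show ?thesis using deaf[OF k(1) lP] by blast
    qed
  qed
  ultimately have snd: "core (Par N (node_list m \<nu>m f is))
      (LSnd (m k) v (\<nu>m k - m ` (set is - {k}) - nds N)) (dirac (Par N (node_list m \<nu>m (\<lambda>_. PNil) is)))"
    unfolding pard_dirac[symmetric] by (rule core_BcastR) simp
  have rcv: "core (node_list n \<nu>n (\<lambda>j. fwdc (q j)) js) (LRcv (m k) v)
      (dirac (node_list n \<nu>n (\<lambda>j. resndc (Val v) (q j)) js))"
  proof (rule core_rcv_node_list)
    fix j assume j: "j \<in> set js"
    then have "(n j, \<nu>n j) \<in> set (sites ?top)" by simp
    from topology_ok_sym[OF top[of f f] sk this] show "m k \<in> \<nu>n j" using covers[OF k(1)] j by blast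
  qed
  \<comment> \<open>The other senders, the nodes of \<open>N\<close> and the forwarders are removed;
    by \<open>enclosed\<close> only the sender itself could remain, and it is not its own
    neighbour.\<close>
  have "\<nu>m k - m ` (set is - {k}) - nds N - n ` set js = {}"
  proof -
    have "m k \<notin> \<nu>m k" using top[of f f] sk unfolding topology_ok_def by blast
    then show ?thesis using enclosed[OF k(1)] by blast
  qed
  then have "core (state f) (LSnd (m k) v {}) (dirac goal)"
    unfolding state_def goal_def by (subst pard_dirac[symmetric]) (rule core_BcastL[OF snd rcv], simp)
  then show ?thesis unfolding silent_def by blast
qed

lemma reaches_state_step:
  assumes k: "k \<in> set is" "f k = sndg (Val v) (p k)"
    and x: "reaches goal (state (f(k := sending))) x" "reaches goal (state (f(k := PNil))) y"
  shows "reaches goal (state f) (p k * x + (1 - p k) * y)"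
proof -
  let ?\<Delta> = "list_dist (map (\<lambda>(w, P). (w, state (f(k := P)))) (oplus (p k) sending PNil))"
  define c where "c B = (if B = state (f(k := sending)) then x else y)" for B
  \<comment> \<open>The two outcomes must be different networks, since \<open>c\<close> attaches its
    bounds to networks and not to outcomes of the coin.\<close>
  have "state (f(k := PNil)) \<noteq> state (f(k := sending))"
    unfolding state_def using node_list_inject[OF _ k(1), of m \<nu>m "f(k := PNil)" "f(k := sending)"] by auto
  then have c: "c (state (f(k := sending))) = x" "c (state (f(k := PNil))) = y"
    by (auto simp: c_def)
  show ?thesis
  proof (rule reaches_step[where \<Delta> = ?\<Delta> and c = c])
    show "silent (state f) ?\<Delta>"
      by (rule silent_state_tau[OF k(1)]) (simp add: k(2) sndg_def)
    show "reaches goal B (c B)" if B: "B \<in> supp ?\<Delta>" for B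
    proof -
      have "B = state (f(k := sending)) \<or> B = state (f(k := PNil))"
        using B supp_list_dist by (fastforce simp: oplus_def split: if_splits)
      then show ?thesis using c x by metis
    qed
    \<comment> \<open>\<open>oplus\<close> collapses the choice at probability 0 and 1; the
      expectation is the same expression in all three cases.\<close>
    show "p k * x + (1 - p k) * y \<le> expect ?\<Delta> c"
      unfolding expect_list_dist oplus_def by (simp add: c)
  qed
qed

text \<open>\<open>K\<close> holds the senders still undecided while \<open>i\<close> is ready to
  send. A further decision to send is given the bound 0, which leaves the product of the
  refusals.\<close>

lemma reaches_state_sending:
  assumes "finite K" "K \<subseteq> set is" "i \<in> set is - K" "f i = sending"
    "\<And>k. k \<in> K \<Longrightarrow> f k = sndg (Val v) (p k)" "\<And>k. k \<in> set is - K - {i} \<Longrightarrow> f k = PNil"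
  shows "reaches goal (state f) (\<Prod>j\<in>K. 1 - p j)"
  using assms
proof (induction K arbitrary: f)
  case empty
  have "silent (state f) (dirac goal)"
    by (rule silent_state_snd[of i]) (use empty in auto)
  then show ?case by (rule reaches_step[where c="\<lambda>_. 1"]) (auto intro: reaches_done sc_refl)
next
  case (insert k K)
  have "reaches goal (state (f(k := PNil))) (\<Prod>j\<in>K. 1 - p j)"
    by (rule insert.IH) (use insert.hyps insert.prems in auto)
  then have "reaches goal (state f) (p k * 0 + (1 - p k) * (\<Prod>j\<in>K. 1 - p j))"
    using insert.prems by (intro reaches_state_step[OF _ _ reaches_zero]) auto
  then show ?case using insert.hyps by simp
qed

text \<open>Situation before the first success: every sender outside \<open>K\<close> has declined.
  The two summands of \<open>exactly_one_insert\<close> are the two outcomes of the coin of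
  \<open>k\<close>.\<close>

lemma reaches_state_idle:
  assumes "finite K" "K \<subseteq> set is"
    "\<And>k. k \<in> K \<Longrightarrow> f k = sndg (Val v) (p k)" "\<And>k. k \<in> set is - K \<Longrightarrow> f k = PNil"
  shows "reaches goal (state f) (exactly_one p K)"
  using assms
proof (induction K arbitrary: f)
  case empty
  then show ?case by (simp add: exactly_one_def reaches_zero)
next
  case (insert k K)
  have "reaches goal (state (f(k := sending))) (\<Prod>j\<in>K. 1 - p j)"
    by (rule reaches_state_sending[of K k]) (use insert.hyps insert.prems in auto)
  moreover have "reaches goal (state (f(k := PNil))) (exactly_one p K)"
    by (rule insert.IH) (use insert.hyps insert.prems in auto)
  ultimately show ?case
    unfolding exactly_one_insert[OF insert.hyps] using insert.prems by (intro reaches_state_step) auto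
qed

end

theorem theorem4p1:
  fixes I J :: "nat set" and v :: 'v and p q :: "nat \<Rightarrow> real"
    and m n :: "nat \<Rightarrow> 'n" and \<nu>m \<nu>n :: "nat \<Rightarrow> 'n set"
    and M N :: "('n, 'v) net"
  assumes "finite I" and "finite J" and "I \<inter> J = {}"
    and "\<forall>i\<in>I. 0 \<le> p i \<and> p i \<le> 1"
    and "\<forall>j\<in>J. 0 \<le> q j \<and> q j \<le> 1"
    and "wf_net M"
    and "scong M (Par (Par N (nprod I (\<lambda>i. Node (m i) (sndg (Val v) (p i)) (\<nu>m i))))
                        (nprod J (\<lambda>j. Node (n j) (fwdc (q j)) (\<nu>n j))))"
    and "\<forall>i\<in>I. n ` J \<subseteq> \<nu>m i \<and> \<nu>m i \<subseteq> nds M"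
    and "\<forall>i\<in>I. \<forall>(k, P, \<mu>)\<in>set (nodes N). k \<in> \<nu>m i \<longrightarrow> \<not> rcv P"
  shows "wsim (Par (Par N (nprod I (\<lambda>i. Node (m i) PNil (\<nu>m i))))
                    (nprod J (\<lambda>j. Node (n j) (resndc (Val v) (q j)) (\<nu>n j))))
              (1 - (\<Sum>i\<in>I. p i * (\<Prod>j\<in>I - {i}. 1 - p j)))
              M"
  unfolding wsim_def nprod_node_list exactly_one_def[symmetric]
proof (rule mdist_le_reaches)
  define "is" js where "is = sorted_list_of_set I" and "js = sorted_list_of_set J"
  have sets: "set is = I" "set js = J" "distinct is" using assms(1,2) by (auto simp: is_def js_def)
  define f where "f = (\<lambda>i. sndg (Val v) (p i))"
  define M0 where "M0 = Par (Par N (node_list m \<nu>m f is)) (node_list n \<nu>n (\<lambda>j. fwdc (q j)) js)"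
  have MM0: "scong M M0" using assms(7) unfolding M0_def f_def is_def js_def nprod_node_list .
  show "0 \<le> 1 - exactly_one p I" "1 - exactly_one p I \<le> 1"
    using exactly_one_bounds[OF assms(1,4)] by auto
  fix A B l \<Delta>
  assume A: "scong A (Par (Par N (node_list m \<nu>m (\<lambda>i. PNil) (sorted_list_of_set I)))
      (node_list n \<nu>n (\<lambda>j. resndc (Val v) (q j)) (sorted_list_of_set J)))" (is "scong A ?L")
    and tr: "trans A l \<Delta>" "topology_ok A" "alpha_lab l" and B: "scong B M" "wf_net B"
  \<comment> \<open>Every label allowed by \<open>alpha_lab\<close> comes from a \<open>core\<close>
    transition, and these exist only for \<open>bot_free\<close> networks; congruence hands this on
    to \<open>N\<close>.\<close>
  have "bot_free A"
    using trans_core[OF tr(1,2)] tr(3) core_bot_free unfolding silent_def alpha_lab_def by fastforce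
  then have bf: "bot_free N" using scong_bot_free[OF A] by simp
  have "topology_ok M0" using topology_ok_scong MM0 assms(6) wf_net_topology_ok by blast
  \<comment> \<open>\<open>topology_ok\<close> looks at \<open>sites\<close> only, so the processes
    in \<open>M0\<close> may be exchanged freely.\<close>
  then have top: "topology_ok (Par (Par N (node_list m \<nu>m f' is)) (node_list n \<nu>n g js))" for f' g
    unfolding topology_ok_def M0_def sites_simps sites_node_list .
  have nds: "nds M = nds N \<union> m ` I \<union> n ` J"
    using scong_nds[OF MM0] by (simp add: M0_def sets)
  interpret gossip_round N "is" js m n \<nu>m \<nu>n p q v
    by unfold_locales (use sets assms(4,8,9) bf top nds in \<open>auto simp del: sites_simps\<close>)
  have "reaches goal (state f) (exactly_one p I)"
    by (rule reaches_state_idle) (use assms(1) sets f_def in auto)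
  moreover have "scong (state f) B"
    using MM0 B(1) sc_trans sc_sym unfolding M0_def state_def by blast
  moreover have "valid_net B" using valid_net_wf B(2) .
  ultimately have "reaches goal B (exactly_one p I)" using reaches_scong valid_net_scong by blast
  then show "reaches ?L B (1 - (1 - exactly_one p I))" unfolding goal_def unfolding is_def js_def by simp
qed

end
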